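(* Let $(X_n)_{n\ge 1}$ be a $(\xi_n)_{n\ge 0}$-almost conditionally identically distributed (a.c.i.d.) sequence with respect to the filtration $\mathcal{G}=(\mathcal{G}_n)_{n\ge 0}$, and let $(\alpha_n)_{n\ge 0}$, $\alpha_n(\omega,A)=\mathbb{P}(X_{n+1}\in A\mid \mathcal{G}_n)(\omega)$, be the corresponding sequence of one-step-ahead predictive distributions. If $$\sum_{n=0}^\infty \xi_n<\infty\quad\text{almost surely},$$ then there exists a random probability measure $\alpha:\Omega\times\mathcal{E}\to[0,1]$ on $(E,\mathcal{E})$ such that $$\mathbb{P}\big(\omega\in\Omega:\ \alpha_n(\omega,\cdot)\to\alpha(\omega,\cdot)\ \text{weakly as } n\to\infty\big)=1 .$$ Moreover, $(X_n)_{n\ge1}$ is asymptotically exchangeable: as $n\to\infty$, $$(X_n,X_{n+1},\ldots)\ \to\ (Z_1,Z_2,\ldots)\quad\text{in distribution},$$ where $Z=(Z_1,Z_2,\ldots)$ is an exchangeable sequence directed by $\alpha$.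
   Context: All random variables are defined on a common probability space $(\Omega,\mathcal{A},\mathbb{P})$; $\mathcal{G}=(\mathcal{G}_n)_{n\ge0}$ is a filtration on it with $\mathcal{G}_0$ trivial; $E$ is a Polish space with Borel $\sigma$-algebra $\mathcal{E}$; $(X_n)_{n\ge1}$ is a $\mathcal{G}$-adapted sequence of $E$-valued random variables. The predictive distributions $\alpha_n$ are taken as regular conditional distributions. Definition (a.c.i.d.). Let $(\xi_n)_{n\ge0}$ be a sequence of $\mathcal{G}$-adapted non-negative random variables. The sequence $(X_n)_{n\ge1}$ is $(\xi_n)_{n\ge0}$-a.c.i.d. with respect to $\mathcal{G}$ if for every $A\in\mathcal{E}$ and every $n\ge0$, $$\mathbb{E}\big(\mathbb{P}(X_{n+2}\in A\mid\mathcal{G}_{n+1})\mid\mathcal{G}_n\big)\le \mathbb{P}(X_{n+1}\in A\mid\mathcal{G}_n)+\xi_n\quad\text{a.s.}$$ Equivalently, for every $n\ge 0$, the total variation distance ($\sup_{A\in\mathcal{E}}$ of the absolute difference) between $\mathbb{P}(X_{n+2}\in\cdot\mid\mathcal{G}_n)$ and $\mathbb{P}(X_{n+1}\in\cdot\mid\mathcal{G}_n)$ is at most $\xi_n$ a.s. An exchangeable sequence $Z$ is directed by the random probability measure $\alpha$ if its law is the mixture of i.i.d. laws given by $\alpha$, i.e. $\mathbb{P}(Z_1\in A_1,\ldots,Z_k\in A_k)=\mathbb{E}\big[\prod_{j=1}^k\alpha(A_j)\big]$ for all $k\geq 1$ and $A_1,\ldots,A_k\in\mathcal{E}$. Convergence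 in distribution of sequences is in $E^{\infty}$ with the product topology. *)

theory Defs
  imports "HOL-Probability.Probability"
begin

text \<open>The conditional probability \<open>P(Y \<in> A | F)\<close>; only the \<open>\<sigma>\<close>-algebra of \<open>F\<close> matters.\<close>

definition cond_prob_in ::
  "'a measure \<Rightarrow> 'a measure \<Rightarrow> ('a \<Rightarrow> 'e) \<Rightarrow> 'e set \<Rightarrow> 'a \<Rightarrow> real" where
  "cond_prob_in M F Y A = real_cond_exp M F (\<lambda>\<omega>. indicat_real A (Y \<omega>))"

definition regular_cond_distribution ::
  "'a measure \<Rightarrow> 'a measure \<Rightarrow> ('a \<Rightarrow> 'e::topological_space) \<Rightarrow> ('a \<Rightarrow> 'e measure) \<Rightarrow> bool" where
  "regular_cond_distribution M F Y \<kappa> \<longleftrightarrow>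
     \<kappa> \<in> F \<rightarrow>\<^sub>M prob_algebra borel \<and>
     (\<forall>A\<in>sets borel. AE \<omega> in M. measure (\<kappa> \<omega>) A = cond_prob_in M F Y A \<omega>)"

text \<open>The sequence \<open>X\<close> is indexed from 1: the value \<open>X 0\<close> is never used.\<close>

definition acid ::
  "'a measure \<Rightarrow> (nat \<Rightarrow> 'a measure) \<Rightarrow> (nat \<Rightarrow> 'a \<Rightarrow> real)
    \<Rightarrow> (nat \<Rightarrow> 'a \<Rightarrow> 'e::topological_space) \<Rightarrow> bool" where
  "acid M G \<xi> X \<longleftrightarrow>
     (\<forall>n. \<xi> n \<in> borel_measurable (G n)) \<and>
     (\<forall>n. \<forall>\<omega>\<in>space M. 0 \<le> \<xi> n \<omega>) \<and>
     (\<forall>A\<in>sets borel. \<forall>n. AE \<omega> in M.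
        real_cond_exp M (G n) (cond_prob_in M (G (n + 1)) (X (n + 2)) A) \<omega>
          \<le> cond_prob_in M (G n) (X (n + 1)) A \<omega> + \<xi> n \<omega>)"

definition weakly_converges ::
  "(nat \<Rightarrow> 'b::topological_space measure) \<Rightarrow> 'b measure \<Rightarrow> bool" where
  "weakly_converges \<mu> \<nu> \<longleftrightarrow>
     (\<forall>f :: 'b \<Rightarrow> real. continuous_on UNIV f \<and> bounded (range f) \<longrightarrow>
        (\<lambda>n. \<integral>x. f x \<partial>\<mu> n) \<longlonglongrightarrow> (\<integral>x. f x \<partial>\<nu>))"

text \<open>In the next two definitions \<open>Z\<close> is indexed from 0, so \<open>Z i\<close> plays the role of
  \<open>Z\<^sub>i\<^sub>+\<^sub>1\<close>. The measure \<open>borel\<close> on \<open>nat \<Rightarrow> 'e\<close> is the Borel \<open>\<sigma>\<close>-algebra of the product topology.\<close>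

definition exchangeable ::
  "'c measure \<Rightarrow> (nat \<Rightarrow> 'c \<Rightarrow> 'e::topological_space) \<Rightarrow> bool" where
  "exchangeable N Z \<longleftrightarrow>
     (\<forall>i. Z i \<in> borel_measurable N) \<and>
     (\<forall>k \<pi>. \<pi> permutes {..<k} \<longrightarrow>
        distr N borel (\<lambda>\<omega> i. Z (\<pi> i) \<omega>) = distr N borel (\<lambda>\<omega> i. Z i \<omega>))"

text \<open>The sequence \<open>Z\<close> and its directing random measure \<open>\<alpha>\<close> may live on different spaces.\<close>

definition directed_by ::
  "'c measure \<Rightarrow> (nat \<Rightarrow> 'c \<Rightarrow> 'e::topological_space) \<Rightarrow> 'a measure \<Rightarrow> ('a \<Rightarrow> 'e measure) \<Rightarrow> bool" where
  "directed_by N Z M \<alpha> \<longleftrightarrow>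
     (\<forall>k\<ge>1. \<forall>A. (\<forall>j<k. A j \<in> sets borel) \<longrightarrow>
        measure N {\<omega>\<in>space N. \<forall>j<k. Z j \<omega> \<in> A j}
          = (\<integral>\<omega>. (\<Prod>j<k. measure (\<alpha> \<omega>) (A j)) \<partial>M))"

end

theory Submission
  imports Defs
begin

text \<open>
  Fix a Borel set \<open>A\<close>. The a.c.i.d. condition for \<open>A\<close> and for its complement says that the predictive
  probabilities \<open>\<alpha> n (A)\<close> form a process in \<open>[0, 1]\<close> whose conditional drift at time \<open>n\<close> is at most
  \<open>\<xi> n\<close> (\<open>almost_martingale_predictive\<close>). As the drifts are almost surely summable, such a process
  converges almost surely (\<open>AE_convergent\<close>): stopped when the accumulated drift exceeds a level \<open>K\<close>,
  its squared increments have summable expectations, and a maximal inequality of Kolmogorov type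
  (\<open>maximal_inequality\<close>) shows that the oscillations die out.

  Convergence of \<open>\<alpha> n (A)\<close> for all \<open>A\<close> in a countable algebra \<open>C\<close> generated by a basis of the topology
  yields, almost surely, an additive limit on \<open>C\<close>. It is countably additive: by inner regularity there
  are compact subsets of \<open>A\<close> that exhaust its mass for the laws of all \<open>X n\<close>, and the growth bound for
  almost martingales transfers this to the asymptotic predictive mass of the remainders
  (\<open>AE_limits_vanish\<close>, \<open>AE_predictive_tight\<close>). Hence the limit extends to a random probability measure
  (\<open>ex_measure_of_setwise_limit\<close>, \<open>ex_setwise_limit_kernel\<close>). Since \<open>C\<close> is closed under intersections
  and every open set is a countable union of members of \<open>C\<close>, setwise convergence on \<open>C\<close> implies weak
  convergence (\<open>weakly_converges_if_pi_system_converges\<close>).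

  For asymptotic exchangeability, \<open>Z\<close> is the coordinate process under the mixture of the infinite
  product measures of the limit \<open>\<alpha>\<close>. The probability that \<open>X (n + 1), \<dots>, X (n + k)\<close> lie in sets
  \<open>A 0, \<dots>, A (k - 1)\<close> of \<open>C\<close> is evaluated by conditioning from the last coordinate backwards, each time
  replacing a late predictive distribution by \<open>\<alpha> n\<close>; the limit is the expectation of the product of
  the \<open>\<alpha> (A j)\<close> (\<open>cylinder_expectation_tendsto\<close>). Boxes with sides in \<open>C\<close> again form a system to which
  the criterion for weak convergence applies, now in \<open>E\<^sup>\<infinity>\<close>.
\<close>

section \<open>Criteria for weak convergence\<close>

text \<open>Together with the next lemma this evaluates the layer sum of a function \<open>g\<close> at mesh \<open>1 / m\<close>:
  the number of levels \<open>1 / m, \<dots>, m / m\<close> strictly below \<open>g x\<close> differs from \<open>m * g x\<close> by at most one.\<close>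

lemma count_levels_below:
  fixes y :: real
  assumes "0 \<le> y" "y \<le> real m"
  shows "y - 1 \<le> real (card {i. i < m \<and> real i + 1 < y})"
    and "real (card {i. i < m \<and> real i + 1 < y}) \<le> y"
proof -
  \<comment> \<open>Truncated subtraction gives the empty set for \<open>y = 0\<close>.\<close>
  have "{i. i < m \<and> real i + 1 < y} = {..<nat \<lceil>y\<rceil> - 1}"
  proof (intro set_eqI iffI)
    fix i assume "i \<in> {i. i < m \<and> real i + 1 < y}"
    then show "i \<in> {..<nat \<lceil>y\<rceil> - 1}" by simp linarith
  next
    fix i assume "i \<in> {..<nat \<lceil>y\<rceil> - 1}"
    then have "int i + 1 < \<lceil>y\<rceil>" by simp
    then have "real i + 1 < y" by linarith
    with assms show "i \<in> {i. i < m \<and> real i + 1 < y}" by simp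
  qed
  then have c: "card {i. i < m \<and> real i + 1 < y} = nat \<lceil>y\<rceil> - 1" by simp
  show "y - 1 \<le> real (card {i. i < m \<and> real i + 1 < y})" unfolding c using assms by linarith
  show "real (card {i. i < m \<and> real i + 1 < y}) \<le> y" unfolding c using assms by linarith
qed

lemma sum_indicator_levels:
  fixes g :: "'b \<Rightarrow> real"
  shows "(\<Sum>i<m. indicator {x. (real i + 1) / real m < g x} x) =
    real (card {i. i < m \<and> real i + 1 < real m * g x})"
proof -
  have "(\<Sum>i<m. indicator {x. (real i + 1) / real m < g x} x) =
     (\<Sum>i\<in>{..<m}. if i \<in> {i. i < m \<and> real i + 1 < real m * g x} then 1 else (0::real))"
    by (intro sum.cong) (auto simp: indicator_def field_simps)
  also have "\<dots> = real (card {i. i < m \<and> real i + 1 < real m * g x})"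
    by (subst sum.If_cases) (auto intro!: arg_cong[where f = card])
  finally show ?thesis .
qed

text \<open>A continuous function with values in \<open>[0, 1]\<close> is uniformly within \<open>1 / m\<close> of the average of the
  indicators of \<open>m\<close> of its strict superlevel sets. These are open, so lower bounds for the measures
  of open sets turn into a lower bound for the integral.\<close>

lemma integral_lower_bound_if_open_lower_bound:
  fixes \<mu> :: "nat \<Rightarrow> 'b::topological_space measure" and g :: "'b \<Rightarrow> real"
  assumes \<mu>: "\<And>n. prob_space (\<mu> n)" "\<And>n. sets (\<mu> n) = sets borel"
    and \<nu>: "prob_space \<nu>" "sets \<nu> = sets borel"
    and op: "\<And>U e. open U \<Longrightarrow> 0 < e \<Longrightarrow> \<forall>\<^sub>F n in sequentially. measure \<nu> U - e < measure (\<mu> n) U"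
    and g: "continuous_on UNIV g" "\<And>x. 0 \<le> g x" "\<And>x. g x \<le> 1" and e: "0 < e"
  shows "\<forall>\<^sub>F n in sequentially. (\<integral>x. g x \<partial>\<nu>) - e < (\<integral>x. g x \<partial>\<mu> n)"
proof -
  obtain m :: nat where m: "0 < m" "1 / real m < e / 2"
    using e by (metis half_gt_zero nat_approx_posE zero_less_Suc)
  define U where "U i = {x. (real i + 1) / real m < g x}" for i
  have U: "open (U i)" for i
    unfolding U_def using g(1) by (intro open_Collect_less continuous_intros) auto
  have sandwich: "g x - 1 / real m \<le> (\<Sum>i<m. indicator (U i) x) / real m \<and>
      (\<Sum>i<m. indicator (U i) x) / real m \<le> g x" for x
  proof -
    have y: "0 \<le> real m * g x" "real m * g x \<le> real m"
      using g(2,3)[of x] by (auto simp: mult_left_le)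
    have "(real m * g x - 1) / real m \<le> (\<Sum>i<m. indicator (U i) x) / real m"
        "(\<Sum>i<m. indicator (U i) x) / real m \<le> real m * g x / real m"
      unfolding U_def sum_indicator_levels using count_levels_below[OF y]
      by (intro divide_right_mono; simp)+
    then show ?thesis using m(1) by (simp add: diff_divide_distrib)
  qed
  have gm: "g \<in> borel_measurable borel" by (rule borel_measurable_continuous_onI[OF g(1)])
  have level: "(\<integral>x. (\<Sum>i<m. indicator (U i) x) / real m \<partial>N) = (\<Sum>i<m. measure N (U i)) / real m
       \<and> integrable N (\<lambda>x. (\<Sum>i<m. indicator (U i) x) / real m) \<and> integrable N g"
    if N: "prob_space N" "sets N = sets borel" for N
  proof -
    interpret prob_space N by fact
    have [measurable]: "U i \<in> sets N" for i using U N by simp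
    have [measurable]: "g \<in> borel_measurable N" using gm N(2) by (simp cong: measurable_cong_sets)
    have "space N = UNIV" using N(2) sets_eq_imp_space_eq by fastforce
    then have "(\<integral>x. (\<Sum>i<m. indicator (U i) x) / real m \<partial>N) = (\<Sum>i<m. measure N (U i)) / real m"
      by (simp add: emeasure_eq_measure)
    moreover have "integrable N (\<lambda>x. (\<Sum>i<m. indicator (U i) x) / real m)"
      by (auto simp: emeasure_eq_measure)
    moreover have "integrable N g"
      by (rule integrable_const_bound[where B = 1]) (use g in auto)
    ultimately show ?thesis by blast
  qed
  have "\<forall>\<^sub>F n in sequentially. \<forall>i\<in>{..<m}. measure \<nu> (U i) - e / 2 < measure (\<mu> n) (U i)"
    using op[OF U] e by (intro eventually_ball_finite) auto
  then show ?thesis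
  proof eventually_elim
    case (elim n)
    interpret \<nu>: prob_space \<nu> by fact
    have "(\<integral>x. g x \<partial>\<nu>) - 1 / real m = (\<integral>x. g x - 1 / real m \<partial>\<nu>)"
      using level[OF \<nu>] by (simp add: \<nu>.prob_space)
    also have "\<dots> \<le> (\<integral>x. (\<Sum>i<m. indicator (U i) x) / real m \<partial>\<nu>)"
      using level[OF \<nu>] sandwich by (intro integral_mono) auto
    also have "\<dots> = (\<Sum>i<m. measure \<nu> (U i)) / real m" using level[OF \<nu>] by blast
    finally have 1: "(\<integral>x. g x \<partial>\<nu>) - 1 / real m \<le> (\<Sum>i<m. measure \<nu> (U i)) / real m" .
    have "(\<Sum>i<m. measure \<nu> (U i)) \<le> (\<Sum>i<m. measure (\<mu> n) (U i) + e / 2)"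
      using elim by (intro sum_mono) (auto simp: less_imp_le algebra_simps)
    then have 2: "(\<Sum>i<m. measure \<nu> (U i)) / real m \<le> (\<Sum>i<m. measure (\<mu> n) (U i)) / real m + e / 2"
      using m(1) divide_right_mono[of _ _ "real m"]
      by (fastforce simp: sum.distrib add_divide_distrib)
    have "(\<Sum>i<m. measure (\<mu> n) (U i)) / real m = (\<integral>x. (\<Sum>i<m. indicator (U i) x) / real m \<partial>\<mu> n)"
      by (rule level[OF \<mu>, THEN conjunct1, symmetric])
    also have "\<dots> \<le> (\<integral>x. g x \<partial>\<mu> n)"
      using level[OF \<mu>] sandwich by (intro integral_mono) auto
    finally show ?case using 1 2 m(2) by linarith
  qed
qed

text \<open>The lower bound for integrals, applied to \<open>g\<close> and to \<open>1 - g\<close>, gives convergence of \<open>\<integral> g\<close>; every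
  bounded continuous function is an affine image of such a \<open>g\<close>.\<close>

lemma weakly_converges_if_open_lower_bound:
  fixes \<mu> :: "nat \<Rightarrow> 'b::topological_space measure"
  assumes \<mu>: "\<And>n. prob_space (\<mu> n)" "\<And>n. sets (\<mu> n) = sets borel"
    and \<nu>: "prob_space \<nu>" "sets \<nu> = sets borel"
    and op: "\<And>U e. open U \<Longrightarrow> 0 < e \<Longrightarrow> \<forall>\<^sub>F n in sequentially. measure \<nu> U - e < measure (\<mu> n) U"
  shows "weakly_converges \<mu> \<nu>"
  unfolding weakly_converges_def
proof (intro allI impI, elim conjE)
  fix f :: "'b \<Rightarrow> real" assume f: "continuous_on UNIV f" "bounded (range f)"
  then obtain B where B: "0 < B" "\<And>x. \<bar>f x\<bar> \<le> B"
    unfolding bounded_pos by auto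
  define g where "g x = (f x + B) / (2 * B)" for x
  have g: "continuous_on UNIV g" "0 \<le> g x" "g x \<le> 1" for x
    unfolding g_def using B(1) B(2)[of x] f(1) by (auto intro!: continuous_intros simp: field_simps)
  have int: "integrable N g" "(\<integral>x. f x \<partial>N) = 2 * B * (\<integral>x. g x \<partial>N) - B"
      "(\<integral>x. 1 - g x \<partial>N) = 1 - (\<integral>x. g x \<partial>N)"
    if N: "prob_space N" "sets N = sets borel" for N :: "'b measure"
  proof -
    interpret prob_space N by fact
    have [measurable]: "g \<in> borel_measurable N"
      using borel_measurable_continuous_onI[OF g(1)] N(2) by (simp cong: measurable_cong_sets)
    show i: "integrable N g"
      by (rule integrable_const_bound[where B = 1]) (use g in auto)
    have "(\<integral>x. f x \<partial>N) = (\<integral>x. 2 * B * g x - B \<partial>N)"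
      unfolding g_def using B(1) by simp
    also have "\<dots> = 2 * B * (\<integral>x. g x \<partial>N) - B" using i by (simp add: prob_space)
    finally show "(\<integral>x. f x \<partial>N) = 2 * B * (\<integral>x. g x \<partial>N) - B" .
    show "(\<integral>x. 1 - g x \<partial>N) = 1 - (\<integral>x. g x \<partial>N)" using i by (simp add: prob_space)
  qed
  have "(\<lambda>n. \<integral>x. g x \<partial>\<mu> n) \<longlonglongrightarrow> (\<integral>x. g x \<partial>\<nu>)"
  proof (rule order_tendstoI)
    fix a assume "a < (\<integral>x. g x \<partial>\<nu>)"
    then show "\<forall>\<^sub>F n in sequentially. a < (\<integral>x. g x \<partial>\<mu> n)"
      using integral_lower_bound_if_open_lower_bound[OF \<mu> \<nu> op g, of "(\<integral>x. g x \<partial>\<nu>) - a"]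
      by (auto elim: eventually_mono)
  next
    fix a assume "(\<integral>x. g x \<partial>\<nu>) < a"
    then show "\<forall>\<^sub>F n in sequentially. (\<integral>x. g x \<partial>\<mu> n) < a"
      using integral_lower_bound_if_open_lower_bound[OF \<mu> \<nu> op, of "\<lambda>x. 1 - g x" "a - (\<integral>x. g x \<partial>\<nu>)"]
        g(2,3) continuous_on_diff[OF continuous_on_const g(1), of 1]
      by (auto elim!: eventually_mono simp: int(3)[OF \<mu>] int(3)[OF \<nu>])
  qed
  then show "(\<lambda>n. \<integral>x. f x \<partial>\<mu> n) \<longlonglongrightarrow> (\<integral>x. f x \<partial>\<nu>)"
    unfolding int(2)[OF \<mu>] int(2)[OF \<nu>] by (intro tendsto_intros)
qed

lemma open_lower_bound_if_increasing_union:
  fixes \<mu> :: "nat \<Rightarrow> 'b::topological_space measure"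
  assumes \<mu>: "\<And>n. prob_space (\<mu> n)" "\<And>n. sets (\<mu> n) = sets borel"
    and \<nu>: "prob_space \<nu>" "sets \<nu> = sets borel"
    and V: "\<And>k. V k \<in> sets borel" "incseq V"
    and low: "\<And>k e. 0 < e \<Longrightarrow> \<forall>\<^sub>F n in sequentially. measure \<nu> (V k) - e < measure (\<mu> n) (V k)"
    and e: "0 < e"
  shows "\<forall>\<^sub>F n in sequentially. measure \<nu> (\<Union>k. V k) - e < measure (\<mu> n) (\<Union>k. V k)"
proof -
  interpret \<nu>: prob_space \<nu> by fact
  have "(\<lambda>k. measure \<nu> (V k)) \<longlonglongrightarrow> measure \<nu> (\<Union>k. V k)"
    by (rule \<nu>.finite_Lim_measure_incseq) (use V \<nu> in auto)
  then have "\<forall>\<^sub>F k in sequentially. measure \<nu> (\<Union>k. V k) - e / 2 < measure \<nu> (V k)"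
    by (rule order_tendstoD) (use e in simp)
  then obtain k where k: "measure \<nu> (\<Union>k. V k) - e / 2 < measure \<nu> (V k)"
    by (auto simp: eventually_sequentially)
  have "\<forall>\<^sub>F n in sequentially. measure \<nu> (V k) - e / 2 < measure (\<mu> n) (V k)"
    by (rule low) (use e in simp)
  then show ?thesis
  proof eventually_elim
    case (elim n)
    interpret prob_space "\<mu> n" by fact
    have "measure (\<mu> n) (V k) \<le> measure (\<mu> n) (\<Union>k. V k)"
      using V(1) \<mu>(2) by (intro finite_measure_mono) auto
    with elim k show ?case by linarith
  qed
qed

text \<open>Inclusion and exclusion in recursive form: adding \<open>A k\<close> to a union of \<open>k\<close> sets changes the measure by
  that of \<open>A k\<close> minus that of the union of the \<open>A i \<inter> A k\<close>, which is again a union of \<open>k\<close> members of \<open>P\<close>.\<close>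

lemma measure_union_converges_if_pi_system:
  fixes \<mu> :: "nat \<Rightarrow> 'b::topological_space measure"
  assumes \<mu>: "\<And>n. prob_space (\<mu> n)" "\<And>n. sets (\<mu> n) = sets borel"
    and \<nu>: "prob_space \<nu>" "sets \<nu> = sets borel"
    and P: "P \<subseteq> sets borel" "\<And>A B. A \<in> P \<Longrightarrow> B \<in> P \<Longrightarrow> A \<inter> B \<in> P"
    and conv: "\<And>A. A \<in> P \<Longrightarrow> (\<lambda>n. measure (\<mu> n) A) \<longlonglongrightarrow> measure \<nu> A"
    and A: "\<And>i. A i \<in> P"
  shows "(\<lambda>n. measure (\<mu> n) (\<Union>i<k::nat. A i)) \<longlonglongrightarrow> measure \<nu> (\<Union>i<k. A i)"
  using A
proof (induction k arbitrary: A)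
  case 0
  then show ?case by simp
next
  case (Suc k)
  have incl_excl: "measure N (\<Union>i<Suc k. A i) =
      measure N (\<Union>i<k. A i) + measure N (A k) - measure N (\<Union>i<k. A i \<inter> A k)"
    if N: "prob_space N" "sets N = sets borel" for N :: "'b measure"
  proof -
    interpret prob_space N by fact
    have [measurable]: "A i \<in> sets N" for i using Suc.prems P N by auto
    have "(\<Union>i<Suc k. A i) = (\<Union>i<k. A i) \<union> A k" by (auto simp: less_Suc_eq)
    then have "measure N (\<Union>i<Suc k. A i) =
        measure N (\<Union>i<k. A i) + measure N (A k) - measure N ((\<Union>i<k. A i) \<inter> A k)"
      by (simp add: measure_Un3 fmeasurable_eq_sets)
    then show ?thesis by (simp add: Int_UN_distrib2)
  qed
  show ?case
    unfolding incl_excl[OF \<mu>] incl_excl[OF \<nu>]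
    using Suc.prems P(2) by (intro tendsto_intros Suc.IH conv) auto
qed

text \<open>This criterion reduces weak convergence to setwise convergence on countably many explicit sets; it is
  used for the predictive distributions on \<open>E\<close> and for the laws of the shifted sequences on \<open>E\<^sup>\<infinity>\<close>.\<close>

lemma weakly_converges_if_pi_system_converges:
  fixes \<mu> :: "nat \<Rightarrow> 'b::topological_space measure"
  assumes \<mu>: "\<And>n. prob_space (\<mu> n)" "\<And>n. sets (\<mu> n) = sets borel"
    and \<nu>: "prob_space \<nu>" "sets \<nu> = sets borel"
    and P: "P \<subseteq> sets borel" "\<And>A B. A \<in> P \<Longrightarrow> B \<in> P \<Longrightarrow> A \<inter> B \<in> P"
    and conv: "\<And>A. A \<in> P \<Longrightarrow> (\<lambda>n. measure (\<mu> n) A) \<longlonglongrightarrow> measure \<nu> A"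
    and opens: "\<And>U. open U \<Longrightarrow> \<exists>A :: nat \<Rightarrow> 'b set. range A \<subseteq> P \<and> U = (\<Union>i. A i)"
  shows "weakly_converges \<mu> \<nu>"
proof (rule weakly_converges_if_open_lower_bound[OF \<mu> \<nu>])
  fix U :: "'b set" and e :: real assume "open U" and e: "0 < e"
  then obtain A :: "nat \<Rightarrow> 'b set" where A: "range A \<subseteq> P" "U = (\<Union>i. A i)"
    using opens by blast
  have U: "U = (\<Union>k. \<Union>i<k. A i)" unfolding A(2) by blast
  show "\<forall>\<^sub>F n in sequentially. measure \<nu> U - e < measure (\<mu> n) U"
    unfolding U
  proof (rule open_lower_bound_if_increasing_union[OF \<mu> \<nu> _ _ _ e])
    show "(\<Union>i<k. A i) \<in> sets borel" for k using A(1) P(1) by auto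
    show "incseq (\<lambda>k. \<Union>i<k. A i)" by (fastforce simp: incseq_def)
    show "\<forall>\<^sub>F n in sequentially. measure \<nu> (\<Union>i<k. A i) - e' < measure (\<mu> n) (\<Union>i<k. A i)"
      if "0 < e'" for k e'
      by (rule order_tendstoD(1)[OF measure_union_converges_if_pi_system[OF \<mu> \<nu> P conv]])
        (use A that in auto)
  qed
qed

text \<open>The functions \<open>min 1 (k * infdist x (- U))\<close> increase to the indicator of \<open>U\<close>. The whole space is
  treated apart because \<open>infdist\<close> to the empty set is \<open>0\<close>.\<close>

lemma open_lower_bound_if_weakly_converges:
  fixes \<mu> :: "nat \<Rightarrow> 'b::metric_space measure"
  assumes \<mu>: "\<And>n. prob_space (\<mu> n)" "\<And>n. sets (\<mu> n) = sets borel"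
    and \<nu>: "prob_space \<nu>" "sets \<nu> = sets borel"
    and w: "weakly_converges \<mu> \<nu>" and U: "open U" and e: "0 < e"
  shows "\<forall>\<^sub>F n in sequentially. measure \<nu> U - e < measure (\<mu> n) U"
proof (cases "U = UNIV")
  case True
  have "measure N U = 1" if "prob_space N" "sets N = sets borel" for N :: "'b measure"
    using prob_space.prob_space[OF that(1)] sets_eq_imp_space_eq[OF that(2)] True by simp
  then show ?thesis using \<mu> \<nu> e by simp
next
  case False
  define f where "f k x = min 1 (real k * infdist x (- U))" for k x
  have f01: "0 \<le> f k x" "f k x \<le> indicator U x" for k x
    unfolding f_def by (auto simp: indicator_def infdist_nonneg)
  have f1: "\<bar>f k x\<bar> \<le> 1" for k x
    using f01(1)[of k x] by (simp add: f_def abs_of_nonneg)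
  have fc: "continuous_on UNIV (f k)" for k
    unfolding f_def by (intro continuous_intros)
  have fb: "bounded (range (f k))" for k
    by (rule boundedI[where B = 1]) (use f1 in auto)
  have flim: "(\<lambda>k. f k x) \<longlonglongrightarrow> indicator U x" for x
  proof (cases "x \<in> U")
    case True
    then have pos: "0 < infdist x (- U)"
      using U False infdist_pos_not_in_closed[of "- U" x] by (auto simp: closed_def)
    obtain k0 :: nat where k0: "1 / infdist x (- U) < real k0" using reals_Archimedean2 by blast
    have "f k x = 1" if "k0 \<le> k" for k
    proof -
      have "1 / infdist x (- U) \<le> real k" using k0 that by linarith
      then have "1 \<le> real k * infdist x (- U)" using pos by (simp add: field_simps)
      then show ?thesis by (simp add: f_def)
    qed
    then have "\<forall>\<^sub>F k in sequentially. f k x = 1" by (auto simp: eventually_sequentially)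
    then show ?thesis using True by (simp add: tendsto_eventually)
  qed (simp add: f_def)
  have ms: "f k \<in> borel_measurable N" "U \<in> sets N" "space N = UNIV"
    if "sets N = sets borel" for k and N :: "'b measure"
    using borel_measurable_continuous_onI[OF fc] that U sets_eq_imp_space_eq[OF that]
    by (auto cong: measurable_cong_sets)
  interpret \<nu>: prob_space \<nu> by fact
  have "(\<lambda>k. \<integral>x. f k x \<partial>\<nu>) \<longlonglongrightarrow> (\<integral>x. indicator U x \<partial>\<nu>)"
  proof (rule integral_dominated_convergence[where w = "\<lambda>_. 1"])
    show "AE x in \<nu>. norm (f k x) \<le> 1" for k using f1 by simp
  qed (use ms[OF \<nu>(2)] flim in auto)
  then have "(\<lambda>k. \<integral>x. f k x \<partial>\<nu>) \<longlonglongrightarrow> measure \<nu> U" using ms[OF \<nu>(2)] by simp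
  then have "\<forall>\<^sub>F k in sequentially. measure \<nu> U - e < (\<integral>x. f k x \<partial>\<nu>)"
    by (rule order_tendstoD) (use e in simp)
  then obtain k where k: "measure \<nu> U - e < (\<integral>x. f k x \<partial>\<nu>)"
    by (auto simp: eventually_sequentially)
  have "(\<lambda>n. \<integral>x. f k x \<partial>\<mu> n) \<longlonglongrightarrow> (\<integral>x. f k x \<partial>\<nu>)"
    using w fc fb unfolding weakly_converges_def by blast
  from order_tendstoD(1)[OF this k] show ?thesis
  proof eventually_elim
    case (elim n)
    interpret prob_space "\<mu> n" by fact
    have "(\<integral>x. f k x \<partial>\<mu> n) \<le> (\<integral>x. indicator U x \<partial>\<mu> n)"
      using ms[OF \<mu>(2)] f01 f1
      by (intro integral_mono integrable_const_bound[where B = 1] AE_I2)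
        (auto simp: indicator_def)
    with elim show ?case using ms[OF \<mu>(2)] by simp
  qed
qed

text \<open>Finite unions of basic open sets suffice to test weak convergence, as every open set is an increasing
  union of them. Only countably many conditions remain, which makes the event that random measures
  converge weakly measurable.\<close>

lemma weakly_converges_iff_countable:
  fixes \<mu> :: "nat \<Rightarrow> 'b::metric_space measure" and U :: "nat \<Rightarrow> 'b set"
  assumes \<mu>: "\<And>n. prob_space (\<mu> n)" "\<And>n. sets (\<mu> n) = sets borel"
    and \<nu>: "prob_space \<nu>" "sets \<nu> = sets borel"
    and U: "topological_basis (range U)"
  shows "weakly_converges \<mu> \<nu> \<longleftrightarrow> (\<forall>(s :: nat list) k. \<forall>\<^sub>F n in sequentially.
    measure \<nu> (\<Union>i\<in>set s. U i) - inverse (real (Suc k)) < measure (\<mu> n) (\<Union>i\<in>set s. U i))"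
    (is "_ \<longleftrightarrow> ?R")
proof
  assume "weakly_converges \<mu> \<nu>"
  moreover have "open (\<Union>i\<in>s. U i)" for s
    using U by (auto simp: topological_basis_open)
  ultimately show ?R
    using open_lower_bound_if_weakly_converges[OF \<mu> \<nu>] by simp
next
  assume R: ?R
  show "weakly_converges \<mu> \<nu>"
  proof (rule weakly_converges_if_open_lower_bound[OF \<mu> \<nu>])
    fix W :: "'b set" and e :: real assume W: "open W" and e: "0 < e"
    define V where "V k = (\<Union>i\<in>{i. i < k \<and> U i \<subseteq> W}. U i)" for k :: nat
    obtain B where B: "B \<subseteq> range U" "\<Union>B = W"
      using U W by (auto simp: topological_basis_def)
    have WV: "W = (\<Union>k. V k)"
    proof
      show "W \<subseteq> (\<Union>k. V k)"
      proof
        fix x assume "x \<in> W"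
        then obtain i where "x \<in> U i" "U i \<subseteq> W" using B by blast
        then have "x \<in> V (Suc i)" by (auto simp: V_def)
        then show "x \<in> (\<Union>k. V k)" by blast
      qed
    qed (auto simp: V_def)
    show "\<forall>\<^sub>F n in sequentially. measure \<nu> W - e < measure (\<mu> n) W"
      unfolding WV
    proof (rule open_lower_bound_if_increasing_union[OF \<mu> \<nu> _ _ _ e])
      show "V k \<in> sets borel" for k
        using U unfolding V_def by (intro borel_open open_UN) (auto simp: topological_basis_open)
      show "incseq V" unfolding incseq_def V_def by (intro allI impI UN_mono) auto
      fix k and e' :: real assume "0 < e'"
      then obtain j where "inverse (real (Suc j)) < e'" using reals_Archimedean by blast
      moreover obtain s where "set s = {i. i < k \<and> U i \<subseteq> W}"
        using finite_list[of "{i. i < k \<and> U i \<subseteq> W}"] by auto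
      then have "\<forall>\<^sub>F n in sequentially. measure \<nu> (V k) - inverse (real (Suc j)) < measure (\<mu> n) (V k)"
        using R[rule_format, of s j] by (simp add: V_def)
      ultimately show "\<forall>\<^sub>F n in sequentially. measure \<nu> (V k) - e' < measure (\<mu> n) (V k)"
        by (auto elim: eventually_mono)
    qed
  qed
qed

section \<open>Bounded processes with summable drift\<close>

locale filtered_prob_space = prob_space M for M :: "'a measure" +
  fixes G :: "nat \<Rightarrow> 'a measure"
  assumes subalg: "\<And>n. subalgebra M (G n)"
    and sets_G_mono: "\<And>m n. m \<le> n \<Longrightarrow> sets (G m) \<subseteq> sets (G n)"
begin

lemma space_G [simp]: "space (G n) = space M"
  using subalg by (auto simp: subalgebra_def)

lemma adapted_measurable: "f \<in> measurable (G n) N \<Longrightarrow> f \<in> measurable M N"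
  by (rule measurable_from_subalg[OF subalg])

lemma measurable_G_mono: "m \<le> n \<Longrightarrow> f \<in> measurable (G m) N \<Longrightarrow> f \<in> measurable (G n) N"
  by (rule measurable_from_subalg[of "G n" "G m"]) (auto simp: subalgebra_def sets_G_mono)

lemma sigma_finite_G: "sigma_finite_subalgebra M (G n)"
  by (rule finite_measure_subalgebra_is_sigma_finite)
    (simp add: finite_measure_subalgebra_def finite_measure_subalgebra_axioms_def subalg
      finite_measure_axioms)

lemma integrable_bounded:
  fixes f :: "'a \<Rightarrow> real"
  assumes "f \<in> borel_measurable M" "\<And>\<omega>. \<omega> \<in> space M \<Longrightarrow> \<bar>f \<omega>\<bar> \<le> B"
  shows "integrable M f"
  by (rule integrable_const_bound[where B = B]) (use assms in auto)

end

locale summable_drift = filtered_prob_space +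
  fixes \<xi> :: "nat \<Rightarrow> 'a \<Rightarrow> real"
  assumes \<xi>_measurable: "\<And>n. \<xi> n \<in> borel_measurable (G n)"
    and \<xi>_nonneg: "\<And>n \<omega>. \<omega> \<in> space M \<Longrightarrow> 0 \<le> \<xi> n \<omega>"
    and \<xi>_summable: "AE \<omega> in M. summable (\<lambda>n. \<xi> n \<omega>)"
begin

definition total_drift :: "nat \<Rightarrow> 'a \<Rightarrow> real" where
  "total_drift n \<omega> = (\<Sum>k\<le>n. \<xi> k \<omega>)"

lemma total_drift_mono:
  assumes "\<omega> \<in> space M" "m \<le> n"
  shows "total_drift m \<omega> \<le> total_drift n \<omega>"
  unfolding total_drift_def using assms by (intro sum_mono2) (auto simp: \<xi>_nonneg)

lemma total_drift_measurable: "total_drift n \<in> borel_measurable (G n)"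
  unfolding total_drift_def
  by (intro borel_measurable_sum measurable_G_mono[OF _ \<xi>_measurable]) auto

text \<open>The variables \<open>\<xi> n\<close> need not be integrable. Indicators \<open>alive K n\<close> of the event that the accumulated
  drift, including \<open>\<xi> n\<close>, is at most \<open>K\<close> are measurable at time \<open>n\<close> and decreasing in \<open>n\<close>, so they
  act as a stopping time that keeps all drifts below \<open>K\<close>. Almost every point stays alive forever for
  some \<open>K\<close>.\<close>

definition alive :: "real \<Rightarrow> nat \<Rightarrow> 'a \<Rightarrow> real" where
  "alive K n \<omega> = (if total_drift n \<omega> \<le> K then 1 else 0)"

lemma alive_measurable: "alive K n \<in> borel_measurable (G n)"
  unfolding alive_def using total_drift_measurable by measurable

lemma alive_range: "0 \<le> alive K n \<omega>" "alive K n \<omega> \<le> 1"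
  by (auto simp: alive_def)

lemma alive_antimono:
  assumes "\<omega> \<in> space M" "m \<le> n"
  shows "alive K n \<omega> \<le> alive K m \<omega>"
  using total_drift_mono[OF assms] by (auto simp: alive_def)

lemma \<xi>_le_total_drift: "\<omega> \<in> space M \<Longrightarrow> \<xi> n \<omega> \<le> total_drift n \<omega>"
  unfolding total_drift_def by (rule member_le_sum) (auto simp: \<xi>_nonneg)

lemma alive_drift_bound:
  assumes "\<omega> \<in> space M" "0 \<le> K"
  shows "0 \<le> alive K n \<omega> * \<xi> n \<omega>" "alive K n \<omega> * \<xi> n \<omega> \<le> K"
  using \<xi>_le_total_drift[OF assms(1), of n] \<xi>_nonneg[OF assms(1), of n] assms(2)
  by (auto simp: alive_def)

text \<open>At the last time \<open>n\<close> at which the point is alive, the accumulated drift is still at most \<open>K\<close>, and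
  later terms vanish.\<close>

lemma sum_alive_drift_le:
  assumes "\<omega> \<in> space M" "0 \<le> K"
  shows "(\<Sum>n<N. alive K n \<omega> * \<xi> n \<omega>) \<le> K"
proof (induction N)
  case (Suc N)
  show ?case
  proof (cases "total_drift N \<omega> \<le> K")
    case True
    have "(\<Sum>n<Suc N. alive K n \<omega> * \<xi> n \<omega>) \<le> (\<Sum>n<Suc N. \<xi> n \<omega>)"
      using \<xi>_nonneg[OF assms(1)] by (intro sum_mono) (auto simp: alive_def)
    with True show ?thesis by (simp add: total_drift_def lessThan_Suc_atMost)
  qed (use Suc in \<open>simp add: alive_def\<close>)
qed (use assms in simp)

definition expected_drift :: "real \<Rightarrow> nat \<Rightarrow> real" where
  "expected_drift K n = (\<integral>\<omega>. alive K n \<omega> * \<xi> n \<omega> \<partial>M)"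

lemma alive_drift_integrable:
  assumes "0 \<le> K"
  shows "integrable M (\<lambda>\<omega>. alive K n \<omega> * \<xi> n \<omega>)"
  by (rule integrable_bounded[where B = K])
    (use alive_drift_bound[OF _ assms] in \<open>auto intro!: borel_measurable_times
      adapted_measurable[OF alive_measurable] adapted_measurable[OF \<xi>_measurable]\<close>)

lemma expected_drift_nonneg: "0 \<le> expected_drift K n"
  unfolding expected_drift_def
  by (intro Bochner_Integration.integral_nonneg) (auto simp: alive_range \<xi>_nonneg)

lemma sum_expected_drift_le:
  assumes "0 \<le> K"
  shows "(\<Sum>n<N. expected_drift K n) \<le> K"
proof -
  have "(\<Sum>n<N. expected_drift K n) = (\<integral>\<omega>. (\<Sum>n<N. alive K n \<omega> * \<xi> n \<omega>) \<partial>M)"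
    unfolding expected_drift_def
    using alive_drift_integrable[OF assms] by (intro Bochner_Integration.integral_sum[symmetric]) auto
  also have "\<dots> \<le> K"
    by (rule integral_le_const)
      (use alive_drift_integrable[OF assms] sum_alive_drift_le[OF _ assms] in auto)
  finally show ?thesis .
qed

lemma expected_drift_summable:
  assumes "0 \<le> K" shows "summable (expected_drift K)"
  by (rule bounded_imp_summable[where B = K])
    (use expected_drift_nonneg sum_expected_drift_le[OF assms, of "Suc _"]
      in \<open>auto simp: lessThan_Suc_atMost\<close>)

lemma AE_alive_forever: "AE \<omega> in M. \<exists>K :: nat. \<forall>n. total_drift n \<omega> \<le> real K"
  using \<xi>_summable AE_space
proof eventually_elim
  case (elim \<omega>)
  obtain K :: nat where K: "(\<Sum>n. \<xi> n \<omega>) \<le> real K" using real_arch_simple by blast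
  have "total_drift n \<omega> \<le> (\<Sum>n. \<xi> n \<omega>)" for n
    unfolding total_drift_def using elim \<xi>_nonneg by (intro sum_le_suminf) auto
  then show ?case using K by (meson order_trans)
qed

end

locale almost_martingale = summable_drift +
  fixes Y :: "nat \<Rightarrow> 'a \<Rightarrow> real"
  assumes adapted: "\<And>n. Y n \<in> borel_measurable (G n)"
    and unit_range: "\<And>n \<omega>. \<omega> \<in> space M \<Longrightarrow> 0 \<le> Y n \<omega> \<and> Y n \<omega> \<le> 1"
    and drift: "\<And>n. AE \<omega> in M. \<bar>real_cond_exp M (G n) (Y (Suc n)) \<omega> - Y n \<omega>\<bar> \<le> \<xi> n \<omega>"
begin

lemma Y_measurable [measurable]: "Y n \<in> borel_measurable M"
  by (rule adapted_measurable[OF adapted])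

lemma alive_measurable_M [measurable]: "alive K n \<in> borel_measurable M"
  by (rule adapted_measurable[OF alive_measurable])

lemma total_drift_measurable_M [measurable]: "total_drift n \<in> borel_measurable M"
  by (rule adapted_measurable[OF total_drift_measurable])

lemma increment_bound: "\<omega> \<in> space M \<Longrightarrow> \<bar>Y m \<omega> - Y n \<omega>\<bar> \<le> 1"
  using unit_range[of \<omega> m] unit_range[of \<omega> n] by auto

text \<open>The only consequence of the drift condition that is used below: tested against a weight that is known
  at time \<open>n\<close> and at most the indicator of being alive, the next increment has expectation at most the
  expected drift.\<close>

lemma expected_increment_le:
  assumes Z: "Z \<in> borel_measurable (G n)" "\<And>\<omega>. \<omega> \<in> space M \<Longrightarrow> \<bar>Z \<omega>\<bar> \<le> alive K n \<omega>" and K: "0 \<le> K"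
  shows "\<bar>\<integral>\<omega>. Z \<omega> * (Y (Suc n) \<omega> - Y n \<omega>) \<partial>M\<bar> \<le> expected_drift K n"
proof -
  interpret G: sigma_finite_subalgebra M "G n" by (rule sigma_finite_G)
  have [measurable]: "Z \<in> borel_measurable M" by (rule adapted_measurable[OF Z(1)])
  have Z1: "\<bar>Z \<omega>\<bar> \<le> 1" if "\<omega> \<in> space M" for \<omega>
    using Z(2)[OF that] alive_range(2)[of K n \<omega>] by linarith
  have ZY: "integrable M (\<lambda>\<omega>. Z \<omega> * Y k \<omega>)" for k
    by (rule integrable_bounded[where B = 1])
      (use Z1 unit_range in \<open>auto simp: abs_mult intro!: mult_le_one\<close>)
  note ce = G.real_cond_exp_intg[OF ZY Z(1) Y_measurable, of "Suc n"]
  have "(\<integral>\<omega>. Z \<omega> * (Y (Suc n) \<omega> - Y n \<omega>) \<partial>M) =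
      (\<integral>\<omega>. Z \<omega> * (real_cond_exp M (G n) (Y (Suc n)) \<omega> - Y n \<omega>) \<partial>M)"
    using ZY ce by (simp add: right_diff_distrib)
  also have "\<bar>\<dots>\<bar> \<le> (\<integral>\<omega>. \<bar>Z \<omega> * (real_cond_exp M (G n) (Y (Suc n)) \<omega> - Y n \<omega>)\<bar> \<partial>M)"
    by (rule integral_abs_bound)
  also have "\<dots> \<le> (\<integral>\<omega>. alive K n \<omega> * \<xi> n \<omega> \<partial>M)"
  proof (rule integral_mono_AE)
    show "integrable M (\<lambda>\<omega>. \<bar>Z \<omega> * (real_cond_exp M (G n) (Y (Suc n)) \<omega> - Y n \<omega>)\<bar>)"
      using ZY ce by (intro integrable_abs) (simp add: right_diff_distrib)
    show "integrable M (\<lambda>\<omega>. alive K n \<omega> * \<xi> n \<omega>)" by (rule alive_drift_integrable[OF K])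
    show "AE \<omega> in M. \<bar>Z \<omega> * (real_cond_exp M (G n) (Y (Suc n)) \<omega> - Y n \<omega>)\<bar> \<le> alive K n \<omega> * \<xi> n \<omega>"
      using drift[of n] AE_space
      by eventually_elim (auto simp: abs_mult intro!: mult_mono Z(2) alive_range)
  qed
  finally show ?thesis by (simp add: expected_drift_def)
qed

definition expected_square :: "real \<Rightarrow> nat \<Rightarrow> real" where
  "expected_square K n = (\<integral>\<omega>. alive K n \<omega> * (Y (Suc n) \<omega> - Y n \<omega>)\<^sup>2 \<partial>M)"

lemma unit_products_integrable [simp]:
  "integrable M (\<lambda>\<omega>. alive K m \<omega>)"
  "integrable M (\<lambda>\<omega>. alive K m \<omega> * Y n \<omega>)"
  "integrable M (\<lambda>\<omega>. alive K m \<omega> * (Y n \<omega>)\<^sup>2)"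
  "integrable M (\<lambda>\<omega>. alive K m \<omega> * (Y n \<omega> - Y l \<omega>)\<^sup>2)"
  "integrable M (\<lambda>\<omega>. alive K m \<omega> * Y l \<omega> * (Y n \<omega> - Y l \<omega>))"
  "integrable M (Y n)"
  by (rule integrable_bounded[where B = 1];
      (measurable; fail)?;
      use alive_range unit_range increment_bound in
        \<open>auto simp: abs_mult power_le_one_iff abs_square_le_1 intro!: mult_le_one\<close>)+

text \<open>Write \<open>(Y' - Y)\<^sup>2 = (Y'\<^sup>2 - Y\<^sup>2) - 2 * Y * (Y' - Y)\<close>. The last term is controlled by the drift.
  The first telescopes, up to the mass that dies between two steps; the potential
  \<open>p n = E (alive n * Y\<^sup>2) - E (alive n)\<close>, which lies in \<open>[-1, 0]\<close>, accounts for that mass because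
  \<open>Y\<^sup>2 \<le> 1\<close>.\<close>

lemma sum_expected_square_le:
  assumes K: "0 \<le> K"
  shows "(\<Sum>n<N. expected_square K n) \<le> 1 + 2 * K"
proof -
  define p where "p n = (\<integral>\<omega>. alive K n \<omega> * (Y n \<omega>)\<^sup>2 \<partial>M) - (\<integral>\<omega>. alive K n \<omega> \<partial>M)" for n
  have step: "expected_square K n \<le> p (Suc n) - p n + 2 * expected_drift K n" for n
  proof -
    have "expected_square K n = (\<integral>\<omega>. alive K n \<omega> * (Y (Suc n) \<omega>)\<^sup>2 - alive K n \<omega> * (Y n \<omega>)\<^sup>2
        - 2 * (alive K n \<omega> * Y n \<omega> * (Y (Suc n) \<omega> - Y n \<omega>)) \<partial>M)"
      unfolding expected_square_def
      by (intro Bochner_Integration.integral_cong) (auto simp: power2_eq_square algebra_simps)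
    also have "\<dots> = (\<integral>\<omega>. alive K n \<omega> * (Y (Suc n) \<omega>)\<^sup>2 \<partial>M) - (\<integral>\<omega>. alive K n \<omega> * (Y n \<omega>)\<^sup>2 \<partial>M)
        - 2 * (\<integral>\<omega>. alive K n \<omega> * Y n \<omega> * (Y (Suc n) \<omega> - Y n \<omega>) \<partial>M)"
      by simp
    finally have 1: "expected_square K n = \<dots>" .
    have "\<bar>\<integral>\<omega>. alive K n \<omega> * Y n \<omega> * (Y (Suc n) \<omega> - Y n \<omega>) \<partial>M\<bar> \<le> expected_drift K n"
      by (rule expected_increment_le[OF _ _ K])
        (use alive_range unit_range in \<open>auto simp: abs_mult intro!: mult_left_le
          borel_measurable_times alive_measurable adapted\<close>)
    moreover have "(\<integral>\<omega>. alive K n \<omega> * (Y (Suc n) \<omega>)\<^sup>2 \<partial>M) \<le> (\<integral>\<omega>. alive K (Suc n) \<omega> * (Y (Suc n) \<omega>)\<^sup>2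
         + alive K n \<omega> - alive K (Suc n) \<omega> \<partial>M)"
    proof (rule integral_mono)
      fix \<omega> assume w: "\<omega> \<in> space M"
      have "(alive K n \<omega> - alive K (Suc n) \<omega>) * (Y (Suc n) \<omega>)\<^sup>2 \<le> alive K n \<omega> - alive K (Suc n) \<omega>"
        using alive_antimono[OF w, of n "Suc n" K] unit_range[OF w, of "Suc n"]
        by (intro mult_left_le power_le_one) auto
      then show "alive K n \<omega> * (Y (Suc n) \<omega>)\<^sup>2 \<le> alive K (Suc n) \<omega> * (Y (Suc n) \<omega>)\<^sup>2
         + alive K n \<omega> - alive K (Suc n) \<omega>" by (simp add: algebra_simps)
    qed auto
    ultimately show ?thesis unfolding 1 p_def by simp
  qed
  have p: "- 1 \<le> p n \<and> p n \<le> 0" for n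
  proof
    have "(\<integral>\<omega>. alive K n \<omega> \<partial>M) \<le> 1"
      by (rule integral_le_const) (auto simp: alive_range)
    moreover have "0 \<le> (\<integral>\<omega>. alive K n \<omega> * (Y n \<omega>)\<^sup>2 \<partial>M)"
      by (intro Bochner_Integration.integral_nonneg) (auto simp: alive_range)
    ultimately show "- 1 \<le> p n" by (simp add: p_def)
    have "(\<integral>\<omega>. alive K n \<omega> * (Y n \<omega>)\<^sup>2 \<partial>M) \<le> (\<integral>\<omega>. alive K n \<omega> \<partial>M)"
      by (intro integral_mono) (use alive_range unit_range in \<open>auto intro!: mult_left_le power_le_one\<close>)
    then show "p n \<le> 0" by (simp add: p_def)
  qed
  have "(\<Sum>n<N. expected_square K n) \<le> (\<Sum>n<N. p (Suc n) - p n + 2 * expected_drift K n)"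
    by (intro sum_mono step)
  also have "\<dots> = p N - p 0 + 2 * (\<Sum>n<N. expected_drift K n)"
    by (simp add: sum.distrib sum_lessThan_telescope sum_distrib_left)
  also have "\<dots> \<le> 1 + 2 * K"
    using p[of N] p[of 0] sum_expected_drift_le[OF K, of N] by linarith
  finally show ?thesis .
qed

text \<open>An upper bound for the growth, in step \<open>n\<close>, of the second moment of a stopped increment: the squared
  increment itself and the cross term.\<close>

definition oscillation_cost :: "real \<Rightarrow> nat \<Rightarrow> real" where
  "oscillation_cost K n = expected_square K n + 2 * expected_drift K n"

lemma oscillation_cost_nonneg: "0 \<le> oscillation_cost K n"
  unfolding oscillation_cost_def expected_square_def
  by (intro add_nonneg_nonneg Bochner_Integration.integral_nonneg mult_nonneg_nonneg)
    (auto simp: alive_range expected_drift_nonneg)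

lemma oscillation_cost_summable:
  assumes K: "0 \<le> K" shows "summable (oscillation_cost K)"
proof (rule bounded_imp_summable[where B = "1 + 4 * K"])
  fix n
  have "(\<Sum>k\<le>n. oscillation_cost K k) =
      (\<Sum>k<Suc n. expected_square K k) + 2 * (\<Sum>k<Suc n. expected_drift K k)"
    unfolding oscillation_cost_def lessThan_Suc_atMost by (simp add: sum.distrib sum_distrib_left)
  also have "\<dots> \<le> 1 + 4 * K"
    using sum_expected_square_le[OF K, of "Suc n"] sum_expected_drift_le[OF K, of "Suc n"] by linarith
  finally show "(\<Sum>k\<le>n. oscillation_cost K k) \<le> 1 + 4 * K" .
qed (rule oscillation_cost_nonneg)

text \<open>A Kolmogorov inequality proved without a Doob decomposition. The indicators \<open>g k\<close> stop the process as
  soon as it has moved by \<open>\<epsilon>\<close> away from \<open>Y m\<close> or died. The stopped increment \<open>T n\<close> is always a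
  difference of two values of \<open>Y\<close>, hence bounded by \<open>1\<close>, so that the cross terms in \<open>E (T n)\<^sup>2\<close> are
  bounded by expected drifts. On the event in question \<open>\<bar>T N\<bar> \<ge> \<epsilon>\<close>, and Markov's inequality applies.\<close>

lemma maximal_inequality:
  assumes K: "0 \<le> K" and \<epsilon>: "0 < \<epsilon>" and mN: "m \<le> N"
  shows "\<epsilon>\<^sup>2 * prob {\<omega>\<in>space M. total_drift N \<omega> \<le> K \<and> (\<exists>n\<in>{m..N}. \<epsilon> \<le> \<bar>Y n \<omega> - Y m \<omega>\<bar>)}
    \<le> (\<Sum>k=m..<N. oscillation_cost K k)"
proof -
  define g where "g k \<omega> = (if total_drift k \<omega> \<le> K \<and> (\<forall>i\<in>{m..k}. \<bar>Y i \<omega> - Y m \<omega>\<bar> < \<epsilon>) then 1 else 0 :: real)"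
    for k \<omega>
  define T where "T n \<omega> = (\<Sum>k=m..<n. g k \<omega> * (Y (Suc k) \<omega> - Y k \<omega>))" for n \<omega>
  have g_meas: "g k \<in> borel_measurable (G k)" if "m \<le> k" for k
  proof -
    have [measurable]: "Y i \<in> borel_measurable (G k)" if "i \<le> k" for i
      by (rule measurable_G_mono[OF that adapted])
    have [measurable]: "total_drift k \<in> borel_measurable (G k)" by (rule total_drift_measurable)
    have "Measurable.pred (G k) (\<lambda>\<omega>. \<forall>i\<in>{m..k}. \<bar>Y i \<omega> - Y m \<omega>\<bar> < \<epsilon>)"
      using that by (intro pred_intros_finite) (auto intro!: borel_measurable_less)
    then show ?thesis unfolding g_def by measurable
  qed
  have T_meas: "T n \<in> borel_measurable (G n)" for n
    unfolding T_def
    by (intro borel_measurable_sum borel_measurable_times borel_measurable_diff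
        measurable_G_mono[OF _ g_meas] measurable_G_mono[OF _ adapted]) auto
  have [measurable]: "T n \<in> borel_measurable M" for n by (rule adapted_measurable[OF T_meas])
  have g_le: "0 \<le> g k \<omega>" "g k \<omega> \<le> alive K k \<omega>" for k \<omega> by (auto simp: g_def alive_def)
  have g_prev: "g j \<omega> = 1" if "g k \<omega> \<noteq> 0" "m \<le> j" "j \<le> k" "\<omega> \<in> space M" for j k \<omega>
    using that total_drift_mono[OF that(4,3)] by (auto simp: g_def split: if_splits)
  have T_run: "T n \<omega> = Y n \<omega> - Y m \<omega>" if "\<And>k. m \<le> k \<Longrightarrow> k < n \<Longrightarrow> g k \<omega> = 1" "m \<le> n" for n \<omega>
  proof -
    have "T n \<omega> = (\<Sum>k=m..<n. Y (Suc k) \<omega> - Y k \<omega>)"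
      unfolding T_def using that(1) by (intro sum.cong) auto
    then show ?thesis using sum_Suc_diff'[OF that(2), of "\<lambda>k. Y k \<omega>"] by simp
  qed
  have T_stopped: "\<exists>j\<ge>m. T n \<omega> = Y j \<omega> - Y m \<omega>" if w: "\<omega> \<in> space M" and "m \<le> n" for n \<omega>
    using that(2)
  proof (induction n rule: dec_induct)
    case base
    show ?case by (auto simp: T_def)
  next
    case (step n)
    show ?case
    proof (cases "g n \<omega> = 0")
      case True
      then show ?thesis using step by (simp add: T_def)
    next
      case False
      have "T (Suc n) \<omega> = Y (Suc n) \<omega> - Y m \<omega>"
        by (rule T_run) (use g_prev[OF False] w step in auto)
      then show ?thesis using step by (intro exI[of _ "Suc n"]) auto
    qed
  qed
  have T1: "\<bar>T n \<omega>\<bar> \<le> 1" if "\<omega> \<in> space M" "m \<le> n" for n \<omega>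
    using T_stopped[OF that] increment_bound[OF that(1)] by auto
  have T_int: "integrable M (\<lambda>\<omega>. (T n \<omega>)\<^sup>2)" if "m \<le> n" for n
    by (rule integrable_bounded[where B = 1]) (use T1 that in \<open>auto simp: abs_square_le_1\<close>)
  have energy: "(\<integral>\<omega>. (T n \<omega>)\<^sup>2 \<partial>M) \<le> (\<Sum>k=m..<n. oscillation_cost K k)" if "m \<le> n" for n
    using that
  proof (induction n rule: dec_induct)
    case base
    show ?case by (simp add: T_def)
  next
    case (step n)
    note mn = \<open>m \<le> n\<close>
    have [measurable]: "g n \<in> borel_measurable M" by (rule adapted_measurable[OF g_meas[OF mn]])
    have Zb: "\<bar>T n \<omega> * g n \<omega>\<bar> \<le> alive K n \<omega>" if "\<omega> \<in> space M" for \<omega>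
      using T1[OF that mn] g_le[of n \<omega>]
      by (simp add: abs_mult) (metis abs_ge_zero mult_left_le_one_le order_trans)
    have i1: "integrable M (\<lambda>\<omega>. T n \<omega> * g n \<omega> * (Y (Suc n) \<omega> - Y n \<omega>))"
    proof (rule integrable_bounded[where B = 1])
      fix \<omega> assume w: "\<omega> \<in> space M"
      have "\<bar>T n \<omega> * g n \<omega>\<bar> * \<bar>Y (Suc n) \<omega> - Y n \<omega>\<bar> \<le> 1"
        using order_trans[OF Zb[OF w] alive_range(2)] increment_bound[OF w] by (intro mult_le_one) simp_all
      then show "\<bar>T n \<omega> * g n \<omega> * (Y (Suc n) \<omega> - Y n \<omega>)\<bar> \<le> 1" by (simp only: abs_mult)
    qed measurable
    have i2: "integrable M (\<lambda>\<omega>. (g n \<omega> * (Y (Suc n) \<omega> - Y n \<omega>))\<^sup>2)"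
      by (rule integrable_bounded[where B = 1])
        (auto simp: g_def abs_square_le_1 increment_bound)
    have "(\<integral>\<omega>. (T (Suc n) \<omega>)\<^sup>2 \<partial>M) = (\<integral>\<omega>. (T n \<omega>)\<^sup>2
        + 2 * (T n \<omega> * g n \<omega> * (Y (Suc n) \<omega> - Y n \<omega>)) + (g n \<omega> * (Y (Suc n) \<omega> - Y n \<omega>))\<^sup>2 \<partial>M)"
      using mn by (intro Bochner_Integration.integral_cong)
        (auto simp: T_def power2_eq_square algebra_simps)
    also have "\<dots> = (\<integral>\<omega>. (T n \<omega>)\<^sup>2 \<partial>M) + 2 * (\<integral>\<omega>. T n \<omega> * g n \<omega> * (Y (Suc n) \<omega> - Y n \<omega>) \<partial>M)
        + (\<integral>\<omega>. (g n \<omega> * (Y (Suc n) \<omega> - Y n \<omega>))\<^sup>2 \<partial>M)"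
      using T_int[OF mn] i1 i2 by simp
    also have "(\<integral>\<omega>. (g n \<omega> * (Y (Suc n) \<omega> - Y n \<omega>))\<^sup>2 \<partial>M) \<le> expected_square K n"
      unfolding expected_square_def
      by (intro integral_mono i2 unit_products_integrable) (auto simp: g_def alive_def)
    also have "(\<integral>\<omega>. T n \<omega> * g n \<omega> * (Y (Suc n) \<omega> - Y n \<omega>) \<partial>M) \<le> expected_drift K n"
      by (rule order_trans[OF abs_ge_self expected_increment_le[OF _ Zb K]])
        (intro borel_measurable_times T_meas g_meas mn)
    finally show ?case using step by (simp add: oscillation_cost_def)
  qed
  let ?A = "{\<omega>\<in>space M. total_drift N \<omega> \<le> K \<and> (\<exists>n\<in>{m..N}. \<epsilon> \<le> \<bar>Y n \<omega> - Y m \<omega>\<bar>)}"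
  have A [measurable]: "?A \<in> sets M" by measurable
  have big: "\<epsilon>\<^sup>2 * indicator ?A \<omega> \<le> (T N \<omega>)\<^sup>2" if w: "\<omega> \<in> space M" for \<omega>
  proof (cases "\<omega> \<in> ?A")
    case True
    \<comment> \<open>At the first time \<open>n\<close> of deviation \<open>\<epsilon>\<close> the sum \<open>T\<close> freezes at \<open>Y n - Y m\<close>.\<close>
    define n where "n = (LEAST n. m \<le> n \<and> \<epsilon> \<le> \<bar>Y n \<omega> - Y m \<omega>\<bar>)"
    obtain n' where n': "m \<le> n'" "n' \<le> N" "\<epsilon> \<le> \<bar>Y n' \<omega> - Y m \<omega>\<bar>" using True by auto
    let ?P = "\<lambda>n. m \<le> n \<and> \<epsilon> \<le> \<bar>Y n \<omega> - Y m \<omega>\<bar>"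
    have n: "m \<le> n" "\<epsilon> \<le> \<bar>Y n \<omega> - Y m \<omega>\<bar>" "n \<le> N"
      using LeastI[of ?P n'] Least_le[of ?P n'] n' unfolding n_def by auto
    have before: "\<bar>Y k \<omega> - Y m \<omega>\<bar> < \<epsilon>" if "m \<le> k" "k < n" for k
      using not_less_Least[of k "\<lambda>n. m \<le> n \<and> \<epsilon> \<le> \<bar>Y n \<omega> - Y m \<omega>\<bar>"] that unfolding n_def by auto
    have after: "g i \<omega> = 0" if "n \<le> i" for i
    proof -
      have "n \<in> {m..i}" "\<not> \<bar>Y n \<omega> - Y m \<omega>\<bar> < \<epsilon>" using n that by auto
      then show ?thesis unfolding g_def by metis
    qed
    have "T N \<omega> = T n \<omega>"
      unfolding T_def using n by (intro sum.mono_neutral_right) (auto simp: after)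
    also have "\<dots> = Y n \<omega> - Y m \<omega>"
    proof (rule T_run)
      fix k assume k: "m \<le> k" "k < n"
      have "total_drift k \<omega> \<le> total_drift N \<omega>" using k n w by (intro total_drift_mono) auto
      then show "g k \<omega> = 1" using True before k by (auto simp: g_def)
    qed (use n in simp)
    finally have "\<epsilon> \<le> \<bar>T N \<omega>\<bar>" using n by simp
    then have "\<epsilon>\<^sup>2 \<le> (T N \<omega>)\<^sup>2" using \<epsilon> by (metis abs_le_square_iff abs_of_pos)
    then show ?thesis using True by simp
  qed simp
  have "\<epsilon>\<^sup>2 * prob ?A = (\<integral>\<omega>. \<epsilon>\<^sup>2 * indicator ?A \<omega> \<partial>M)" by simp
  also have "\<dots> \<le> (\<integral>\<omega>. (T N \<omega>)\<^sup>2 \<partial>M)"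
    by (intro integral_mono T_int mN big) (auto simp: emeasure_eq_measure)
  also have "\<dots> \<le> (\<Sum>k=m..<N. oscillation_cost K k)" by (rule energy[OF mN])
  finally show ?thesis .
qed

text \<open>The maximal inequality bounds the probability of an \<open>\<epsilon>\<close>-oscillation after time \<open>m\<close> on the points that
  stay alive by a tail of the convergent series of oscillation costs, for every \<open>m\<close>.\<close>

lemma oscillation_event_null:
  assumes K: "0 \<le> K" and \<epsilon>: "0 < \<epsilon>"
  shows "AE \<omega> in M. \<not> ((\<forall>N. total_drift N \<omega> \<le> K) \<and> (\<forall>m. \<exists>n\<ge>m. \<epsilon> \<le> \<bar>Y n \<omega> - Y m \<omega>\<bar>))"
proof -
  define B where "B = {\<omega>\<in>space M. (\<forall>N. total_drift N \<omega> \<le> K) \<and> (\<forall>m. \<exists>n\<ge>m. \<epsilon> \<le> \<bar>Y n \<omega> - Y m \<omega>\<bar>)}"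
  define C where "C m N = {\<omega>\<in>space M. (\<forall>N. total_drift N \<omega> \<le> K) \<and> (\<exists>n\<in>{m..N}. \<epsilon> \<le> \<bar>Y n \<omega> - Y m \<omega>\<bar>)}" for m N
  have B_meas [measurable]: "B \<in> sets M" unfolding B_def by measurable
  have C_meas [measurable]: "C m N \<in> sets M" for m N unfolding C_def by measurable
  have tail: "prob B \<le> (\<Sum>k. oscillation_cost K (k + m)) / \<epsilon>\<^sup>2" for m
  proof -
    have CN: "prob (C m N) \<le> (\<Sum>k. oscillation_cost K (k + m)) / \<epsilon>\<^sup>2" for N
    proof (cases "m \<le> N")
      case True
      have "\<epsilon>\<^sup>2 * prob (C m N) \<le> \<epsilon>\<^sup>2 * prob {\<omega>\<in>space M. total_drift N \<omega> \<le> K \<and> (\<exists>n\<in>{m..N}. \<epsilon> \<le> \<bar>Y n \<omega> - Y m \<omega>\<bar>)}"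
        by (intro mult_left_mono finite_measure_mono) (auto simp: C_def)
      also have "\<dots> \<le> (\<Sum>k=m..<N. oscillation_cost K k)" by (rule maximal_inequality[OF K \<epsilon> True])
      also have "\<dots> = (\<Sum>k<N - m. oscillation_cost K (k + m))"
        using sum.shift_bounds_nat_ivl[of "oscillation_cost K" 0 m "N - m"] True
        by (simp add: lessThan_atLeast0)
      also have "\<dots> \<le> (\<Sum>k. oscillation_cost K (k + m))"
        using oscillation_cost_summable[OF K] oscillation_cost_nonneg
        by (intro sum_le_suminf) (auto simp: summable_iff_shift)
      finally show ?thesis using \<epsilon> by (simp add: field_simps)
    next
      case False
      then have "C m N = {}" by (auto simp: C_def)
      then show ?thesis using oscillation_cost_summable[OF K] oscillation_cost_nonneg
        by (auto intro!: divide_nonneg_nonneg suminf_nonneg simp: summable_iff_shift)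
    qed
    have "incseq (C m)" by (fastforce simp: incseq_def C_def)
    then have "(\<lambda>N. prob (C m N)) \<longlonglongrightarrow> prob (\<Union>N. C m N)"
      by (intro finite_Lim_measure_incseq) auto
    then have "prob (\<Union>N. C m N) \<le> (\<Sum>k. oscillation_cost K (k + m)) / \<epsilon>\<^sup>2"
      by (rule LIMSEQ_le_const2) (use CN in blast)
    moreover have "prob B \<le> prob (\<Union>N. C m N)"
      by (rule finite_measure_mono) (force simp: B_def C_def, measurable)
    ultimately show ?thesis by linarith
  qed
  have "(\<lambda>m. (\<Sum>k. oscillation_cost K (k + m)) / \<epsilon>\<^sup>2) \<longlonglongrightarrow> 0 / \<epsilon>\<^sup>2"
    by (intro tendsto_divide suminf_exist_split2 oscillation_cost_summable K tendsto_const) (use \<epsilon> in auto)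
  then have "prob B \<le> 0 / \<epsilon>\<^sup>2" by (rule LIMSEQ_le_const) (use tail in blast)
  then have "prob B = 0" by (simp add: measure_le_0_iff)
  then have "B \<in> null_sets M" by (auto simp: null_sets_def emeasure_eq_measure)
  then show ?thesis by (rule AE_I') (auto simp: B_def)
qed

text \<open>Outside a null set, a point that stays alive for some level \<open>K\<close> has oscillations that are eventually
  smaller than each \<open>1 / (j + 1)\<close>, so the sequence is Cauchy.\<close>

theorem AE_convergent: "AE \<omega> in M. convergent (\<lambda>n. Y n \<omega>)"
proof -
  have "AE \<omega> in M. \<forall>K::nat. \<forall>j::nat. \<not> ((\<forall>N. total_drift N \<omega> \<le> real K) \<and>
      (\<forall>m. \<exists>n\<ge>m. inverse (real (Suc j)) \<le> \<bar>Y n \<omega> - Y m \<omega>\<bar>))"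
    by (intro AE_all_countable[THEN iffD2] allI oscillation_event_null) auto
  with AE_alive_forever show ?thesis
  proof eventually_elim
    case (elim \<omega>)
    have *: "\<exists>m. \<forall>n\<ge>m. \<bar>Y n \<omega> - Y m \<omega>\<bar> < inverse (real (Suc j))" for j
      using elim by (meson not_le)
    have "Cauchy (\<lambda>n. Y n \<omega>)"
    proof (rule CauchyI)
      fix e :: real assume "0 < e"
      then obtain j where j: "inverse (real (Suc j)) < e / 2" using reals_Archimedean half_gt_zero by blast
      obtain m where m: "\<forall>n\<ge>m. \<bar>Y n \<omega> - Y m \<omega>\<bar> < inverse (real (Suc j))" using * by blast
      have "norm (Y p \<omega> - Y q \<omega>) < e" if "m \<le> p" "m \<le> q" for p q
        using m[rule_format, of p] m[rule_format, of q] that j by (simp add: abs_less_iff)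
      then show "\<exists>M. \<forall>m\<ge>M. \<forall>n\<ge>M. norm (Y m \<omega> - Y n \<omega>) < e" by blast
    qed
    then show ?case by (simp add: Cauchy_convergent_iff)
  qed
qed

text \<open>Since \<open>Y\<close> is non-negative, dying only lowers the expectation, and each step raises it by at most the
  expected drift.\<close>

lemma alive_expectation_growth:
  assumes K: "0 \<le> K" and mn: "m \<le> n"
  shows "(\<integral>\<omega>. alive K n \<omega> * Y n \<omega> \<partial>M) \<le> (\<integral>\<omega>. Y m \<omega> \<partial>M) + (\<Sum>k=m..<n. expected_drift K k)"
  using mn
proof (induction n rule: dec_induct)
  case base
  have "(\<integral>\<omega>. alive K m \<omega> * Y m \<omega> \<partial>M) \<le> (\<integral>\<omega>. Y m \<omega> \<partial>M)"
  proof (rule integral_mono)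
    fix \<omega> assume "\<omega> \<in> space M"
    then show "alive K m \<omega> * Y m \<omega> \<le> Y m \<omega>" using unit_range[of \<omega> m] by (simp add: alive_def)
  qed simp_all
  then show ?case by simp
next
  case (step n)
  have "(\<integral>\<omega>. alive K (Suc n) \<omega> * Y (Suc n) \<omega> \<partial>M) \<le> (\<integral>\<omega>. alive K n \<omega> * Y (Suc n) \<omega> \<partial>M)"
  proof (rule integral_mono)
    fix \<omega> assume w: "\<omega> \<in> space M"
    show "alive K (Suc n) \<omega> * Y (Suc n) \<omega> \<le> alive K n \<omega> * Y (Suc n) \<omega>"
      using unit_range[OF w, of "Suc n"] by (intro mult_right_mono alive_antimono[OF w]) simp_all
  qed simp_all
  also have "\<dots> = (\<integral>\<omega>. alive K n \<omega> * Y n \<omega> \<partial>M) + (\<integral>\<omega>. alive K n \<omega> * (Y (Suc n) \<omega> - Y n \<omega>) \<partial>M)"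
    by (simp add: right_diff_distrib)
  also have "(\<integral>\<omega>. alive K n \<omega> * (Y (Suc n) \<omega> - Y n \<omega>) \<partial>M) \<le> expected_drift K n"
    by (rule order_trans[OF abs_ge_self expected_increment_le[OF _ _ K]])
      (auto simp: alive_range alive_measurable)
  finally show ?case using step by simp
qed

lemma expectation_limit_le:
  assumes K: "0 \<le> K"
  shows "(\<integral>\<omega>. (if \<forall>N. total_drift N \<omega> \<le> K then lim (\<lambda>n. Y n \<omega>) else 0) \<partial>M)
    \<le> (\<integral>\<omega>. Y m \<omega> \<partial>M) + (\<Sum>k. expected_drift K (k + m))"
proof -
  let ?I = "\<lambda>n \<omega>. if \<forall>N. total_drift N \<omega> \<le> K then Y n \<omega> else 0"
  have bound: "(\<integral>\<omega>. ?I n \<omega> \<partial>M) \<le> (\<integral>\<omega>. Y m \<omega> \<partial>M) + (\<Sum>k. expected_drift K (k + m))" if "m \<le> n" for n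
  proof -
    have "(\<integral>\<omega>. ?I n \<omega> \<partial>M) \<le> (\<integral>\<omega>. alive K n \<omega> * Y n \<omega> \<partial>M)"
    proof (rule integral_mono)
      show "integrable M (?I n)"
        by (rule integrable_bounded[where B = 1]) (measurable, use unit_range in auto)
      fix \<omega> assume "\<omega> \<in> space M"
      then show "?I n \<omega> \<le> alive K n \<omega> * Y n \<omega>" using unit_range[of \<omega> n] by (simp add: alive_def)
    qed simp
    also have "\<dots> \<le> (\<integral>\<omega>. Y m \<omega> \<partial>M) + (\<Sum>k=m..<n. expected_drift K k)"
      by (rule alive_expectation_growth[OF K that])
    also have "(\<Sum>k=m..<n. expected_drift K k) = (\<Sum>k<n - m. expected_drift K (k + m))"
      using sum.shift_bounds_nat_ivl[of "expected_drift K" 0 m "n - m"] that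
      by (simp add: lessThan_atLeast0)
    also have "\<dots> \<le> (\<Sum>k. expected_drift K (k + m))"
      using expected_drift_summable[OF K] expected_drift_nonneg
      by (intro sum_le_suminf) (auto simp: summable_iff_shift)
    finally show ?thesis by simp
  qed
  have "(\<lambda>n. \<integral>\<omega>. ?I n \<omega> \<partial>M) \<longlonglongrightarrow> (\<integral>\<omega>. (if \<forall>N. total_drift N \<omega> \<le> K then lim (\<lambda>n. Y n \<omega>) else 0) \<partial>M)"
  proof (rule integral_dominated_convergence[where w = "\<lambda>_. 1"])
    show "AE \<omega> in M. (\<lambda>n. ?I n \<omega>) \<longlonglongrightarrow> (if \<forall>N. total_drift N \<omega> \<le> K then lim (\<lambda>n. Y n \<omega>) else 0)"
      using AE_convergent
    proof eventually_elim
      case (elim \<omega>)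
      then show ?case
        by (cases "\<forall>N. total_drift N \<omega> \<le> K")
          (simp_all only: if_True if_False tendsto_const convergent_LIMSEQ_iff simp_thms)
    qed
    show "AE \<omega> in M. norm (?I n \<omega>) \<le> 1" for n using unit_range by (intro AE_I2) auto
    show "(\<lambda>\<omega>. if \<forall>N. total_drift N \<omega> \<le> K then lim (\<lambda>n. Y n \<omega>) else 0) \<in> borel_measurable M"
      by measurable
  qed auto
  then show ?thesis by (rule LIMSEQ_le_const2) (use bound in blast)
qed

end

text \<open>Limits in \<open>n\<close> and \<open>j\<close> need not commute, but here the growth bound is uniform: for every \<open>m\<close> the
  limit of \<open>Y j n\<close> in \<open>n\<close> has expectation, over points alive forever at level \<open>K\<close>, at most \<open>E (Y j m)\<close>
  plus a tail of a convergent series that depends on \<open>K\<close> and \<open>m\<close> only. Letting \<open>j\<close> and then \<open>m\<close> tend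
  to infinity shows that almost surely some limit is below \<open>e\<close>. For predictive probabilities of sets
  this does the work of a Vitali-Hahn-Saks argument.\<close>

lemma (in summable_drift) AE_limits_vanish:
  fixes Y :: "nat \<Rightarrow> nat \<Rightarrow> 'a \<Rightarrow> real"
  assumes am: "\<And>j. almost_martingale M G \<xi> (Y j)"
    and small: "\<And>m. (\<lambda>j. \<integral>\<omega>. Y j m \<omega> \<partial>M) \<longlonglongrightarrow> 0"
  shows "AE \<omega> in M. \<forall>e>0. \<exists>j. \<forall>\<^sub>F n in sequentially. Y j n \<omega> < e"
proof -
  have [measurable]: "Y j n \<in> borel_measurable M" for j n
    using almost_martingale.Y_measurable[OF am] .
  have [measurable]: "total_drift n \<in> borel_measurable M" for n
    by (rule adapted_measurable[OF total_drift_measurable])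
  have null: "AE \<omega> in M. \<not> ((\<forall>N. total_drift N \<omega> \<le> K) \<and> (\<forall>j. e \<le> lim (\<lambda>n. Y j n \<omega>)))"
    if K: "0 \<le> K" and e: "0 < e" for K e :: real
  proof -
    define D where "D = {\<omega>\<in>space M. (\<forall>N. total_drift N \<omega> \<le> K) \<and> (\<forall>j. e \<le> lim (\<lambda>n. Y j n \<omega>))}"
    have [measurable]: "D \<in> sets M" unfolding D_def by measurable
    have le: "e * prob D \<le> (\<integral>\<omega>. Y j m \<omega> \<partial>M) + (\<Sum>k. expected_drift K (k + m))" for j m
    proof -
      interpret Y: almost_martingale M G \<xi> "Y j" by (rule am)
      have lim01: "AE \<omega> in M. 0 \<le> lim (\<lambda>n. Y j n \<omega>) \<and> lim (\<lambda>n. Y j n \<omega>) \<le> 1"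
        using Y.AE_convergent AE_space
      proof eventually_elim
        case (elim \<omega>)
        then have "(\<lambda>n. Y j n \<omega>) \<longlonglongrightarrow> lim (\<lambda>n. Y j n \<omega>)" by (simp add: convergent_LIMSEQ_iff)
        then show ?case
          using Y.unit_range[OF elim(2)] by (blast intro: LIMSEQ_le_const LIMSEQ_le_const2)
      qed
      have "e * prob D = (\<integral>\<omega>. e * indicator D \<omega> \<partial>M)" by simp
      also have "\<dots> \<le> (\<integral>\<omega>. (if \<forall>N. total_drift N \<omega> \<le> K then lim (\<lambda>n. Y j n \<omega>) else 0) \<partial>M)"
      proof (rule integral_mono_AE)
        show "integrable M (\<lambda>\<omega>. if \<forall>N. total_drift N \<omega> \<le> K then lim (\<lambda>n. Y j n \<omega>) else 0)"
          by (rule integrable_const_bound[where B = 1]) (use lim01 in \<open>auto elim: eventually_mono\<close>)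
        show "AE \<omega> in M. e * indicator D \<omega> \<le> (if \<forall>N. total_drift N \<omega> \<le> K then lim (\<lambda>n. Y j n \<omega>) else 0)"
          using lim01 by eventually_elim (auto simp: D_def indicator_def)
      qed (auto simp: emeasure_eq_measure)
      also have "\<dots> \<le> (\<integral>\<omega>. Y j m \<omega> \<partial>M) + (\<Sum>k. expected_drift K (k + m))"
        by (rule Y.expectation_limit_le[OF K])
      finally show ?thesis .
    qed
    have "e * prob D \<le> 0 + (\<Sum>k. expected_drift K (k + m))" for m
      by (rule LIMSEQ_le_const[OF tendsto_add[OF small tendsto_const]]) (use le in blast)
    moreover have "(\<lambda>m. \<Sum>k. expected_drift K (k + m)) \<longlonglongrightarrow> 0"
      by (rule suminf_exist_split2[OF expected_drift_summable[OF K]])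
    ultimately have "e * prob D \<le> 0"
      by (intro LIMSEQ_le_const[where X = "\<lambda>m. \<Sum>k. expected_drift K (k + m)"]) auto
    then have "prob D = 0" using e by (simp add: mult_le_0_iff measure_le_0_iff)
    then have "D \<in> null_sets M" by (auto simp: null_sets_def emeasure_eq_measure)
    then show ?thesis by (rule AE_I') (auto simp: D_def)
  qed
  have "AE \<omega> in M. \<forall>K i :: nat. \<not> ((\<forall>N. total_drift N \<omega> \<le> real K) \<and>
      (\<forall>j. inverse (real (Suc i)) \<le> lim (\<lambda>n. Y j n \<omega>)))"
    by (intro AE_all_countable[THEN iffD2] allI null) auto
  moreover have "AE \<omega> in M. \<forall>j. convergent (\<lambda>n. Y j n \<omega>)"
    by (intro AE_all_countable[THEN iffD2] allI almost_martingale.AE_convergent[OF am])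
  ultimately show ?thesis
    using AE_alive_forever
  proof eventually_elim
    case (elim \<omega>)
    show ?case
    proof (intro allI impI)
      fix e :: real assume "0 < e"
      then obtain i where i: "inverse (real (Suc i)) < e" using reals_Archimedean by blast
      obtain j where "lim (\<lambda>n. Y j n \<omega>) < inverse (real (Suc i))" using elim by (meson not_le)
      then have "lim (\<lambda>n. Y j n \<omega>) < e" using i by linarith
      then have "\<forall>\<^sub>F n in sequentially. Y j n \<omega> < e"
        using elim(2) by (intro order_tendstoD(2)) (auto simp: convergent_LIMSEQ_iff)
      then show "\<exists>j. \<forall>\<^sub>F n in sequentially. Y j n \<omega> < e" by blast
    qed
  qed
qed

section \<open>Setwise limits on a countable algebra\<close>

text \<open>The algebra generated by the sets \<open>U i\<close>, encoded through the finitely many bits \<open>x \<in> U i\<close> with \<open>i < n\<close>.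
  In this form it is evidently countable, and two members can be compared at a common \<open>n\<close>.\<close>

definition membership_pattern :: "(nat \<Rightarrow> 'b set) \<Rightarrow> nat \<Rightarrow> 'b \<Rightarrow> nat set" where
  "membership_pattern U n x = {i. i < n \<and> x \<in> U i}"

definition countable_algebra :: "(nat \<Rightarrow> 'b set) \<Rightarrow> 'b set set" where
  "countable_algebra U = {{x. membership_pattern U n x \<in> S} | n S. True}"

lemma countable_algebraI: "{x. membership_pattern U n x \<in> S} \<in> countable_algebra U"
  unfolding countable_algebra_def by blast

lemma countable_countable_algebra: "countable (countable_algebra U)"
proof -
  have "countable_algebra U \<subseteq>
      (\<Union>n. (\<lambda>S. {x. membership_pattern U n x \<in> S}) ` Pow (Pow {..<n}))"
  proof
    fix A assume "A \<in> countable_algebra U"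
    then obtain n S where A: "A = {x. membership_pattern U n x \<in> S}"
      unfolding countable_algebra_def by blast
    have "A = {x. membership_pattern U n x \<in> S \<inter> Pow {..<n}}"
      unfolding A by (auto simp: membership_pattern_def)
    then show "A \<in> (\<Union>n. (\<lambda>S. {x. membership_pattern U n x \<in> S}) ` Pow (Pow {..<n}))"
      by blast
  qed
  then show ?thesis
    by (rule countable_subset) (intro countable_UN[OF countableI_type] countable_finite finite_imageI, simp)
qed

lemma countable_algebra_lift:
  assumes "A \<in> countable_algebra U"
  shows "\<exists>n. \<forall>m\<ge>n. \<exists>S. A = {x. membership_pattern U m x \<in> S}"
proof -
  obtain n S where A: "A = {x. membership_pattern U n x \<in> S}"
    using assms unfolding countable_algebra_def by blast
  have "\<exists>S. A = {x. membership_pattern U m x \<in> S}" if "n \<le> m" for m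
  proof -
    have "membership_pattern U n x = membership_pattern U m x \<inter> {..<n}" for x
      using that by (auto simp: membership_pattern_def)
    then show ?thesis
      unfolding A by (intro exI[of _ "{s. s \<inter> {..<n} \<in> S}"]) simp
  qed
  then show ?thesis by blast
qed

lemma algebra_countable_algebra: "algebra UNIV (countable_algebra U)"
  unfolding algebra_iff_Un
proof (intro conjI ballI)
  show "{} \<in> countable_algebra U" using countable_algebraI[of U 0 "{}"] by simp
  fix A assume A: "A \<in> countable_algebra U"
  then obtain n S where "A = {x. membership_pattern U n x \<in> S}"
    unfolding countable_algebra_def by blast
  then have "UNIV - A = {x. membership_pattern U n x \<in> - S}" by auto
  then show "UNIV - A \<in> countable_algebra U" using countable_algebraI by metis
  fix B assume B: "B \<in> countable_algebra U"
  obtain m where "\<exists>S. A = {x. membership_pattern U m x \<in> S}" "\<exists>S. B = {x. membership_pattern U m x \<in> S}"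
    using countable_algebra_lift[OF A] countable_algebra_lift[OF B] by (meson nat_le_linear order_trans)
  then obtain S S' where "A = {x. membership_pattern U m x \<in> S}" "B = {x. membership_pattern U m x \<in> S'}"
    by blast
  then have "A \<union> B = {x. membership_pattern U m x \<in> S \<union> S'}" by auto
  then show "A \<union> B \<in> countable_algebra U" using countable_algebraI by metis
qed simp

lemma countable_algebra_generator: "U i \<in> countable_algebra U"
proof -
  have "U i = {x. membership_pattern U (Suc i) x \<in> {s. i \<in> s}}"
    by (auto simp: membership_pattern_def)
  then show ?thesis using countable_algebraI by metis
qed

lemma countable_algebra_borel:
  assumes "\<And>i. open (U i)"
  shows "countable_algebra U \<subseteq> sets borel"
proof
  fix A assume "A \<in> countable_algebra U"
  then obtain n S where A: "A = {x. membership_pattern U n x \<in> S}"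
    unfolding countable_algebra_def by blast
  have fibre: "{x. membership_pattern U n x = s} \<in> sets borel" if "s \<subseteq> {..<n}" for s
  proof -
    have "{x. membership_pattern U n x = s} = {x\<in>space borel. \<forall>i\<in>{..<n}. x \<in> (if i \<in> s then U i else - U i)}"
      using that by (auto simp: membership_pattern_def split: if_splits)
    also have "\<dots> \<in> sets borel"
      using borel_open[OF assms]
      by (intro sets.sets_Collect_finite_All) (auto simp: borel_comp)
    finally show ?thesis .
  qed
  have "A = (\<Union>s\<in>S \<inter> Pow {..<n}. {x. membership_pattern U n x = s})"
    unfolding A by (auto simp: membership_pattern_def)
  then show "A \<in> sets borel" using fibre by (auto intro!: sets.finite_UN)
qed

lemma sigma_sets_countable_algebra:
  assumes U: "topological_basis (range U)"
  shows "sigma_sets UNIV (countable_algebra U) = sets borel"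
proof (rule antisym)
  have "open (U i)" for i using U by (auto simp: topological_basis_open)
  from countable_algebra_borel[OF this] show "sigma_sets UNIV (countable_algebra U) \<subseteq> sets borel"
    using sets.sigma_sets_subset[of "countable_algebra U" borel] by simp
  have "sets borel = sigma_sets UNIV (range U)"
    by (subst borel_eq_countable_basis[OF _ U]) auto
  also have "\<dots> \<subseteq> sigma_sets UNIV (countable_algebra U)"
    by (rule sigma_sets_mono') (auto simp: countable_algebra_generator)
  finally show "sets borel \<subseteq> sigma_sets UNIV (countable_algebra U)" .
qed

lemma ex_enumerated_basis:
  "\<exists>U :: nat \<Rightarrow> 'b::second_countable_topology set. topological_basis (range U)"
proof -
  obtain B :: "'b set set" where B: "countable B" "topological_basis B"
    using ex_countable_basis by blast
  have "B \<noteq> {}" using B(2) by (auto simp: topological_basis_def)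
  then have "range (from_nat_into B) = B" using B(1) by (rule range_from_nat_into)
  then show ?thesis using B(2) by metis
qed

lemma open_countable_union_basis:
  assumes U: "topological_basis (range (U :: nat \<Rightarrow> 'b::topological_space set))" and W: "open W"
    and C: "range U \<subseteq> C" "{} \<in> C"
  shows "\<exists>A :: nat \<Rightarrow> 'b set. range A \<subseteq> C \<and> W = (\<Union>i. A i)"
proof -
  obtain B where B: "B \<subseteq> range U" "\<Union>B = W"
    using U W by (auto simp: topological_basis_def)
  define A where "A i = (if U i \<in> B then U i else {})" for i
  have "range A \<subseteq> C" using C by (auto simp: A_def)
  moreover have "W = (\<Union>i. A i)"
  proof
    show "W \<subseteq> (\<Union>i. A i)"
    proof
      fix x assume "x \<in> W"
      then obtain b where "b \<in> B" "x \<in> b" using B by blast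
      then obtain i where "b = U i" using B by blast
      then have "x \<in> A i" using \<open>b \<in> B\<close> \<open>x \<in> b\<close> by (simp add: A_def)
      then show "x \<in> (\<Union>i. A i)" by blast
    qed
    show "(\<Union>i. A i) \<subseteq> W" using B by (auto simp: A_def split: if_splits)
  qed
  ultimately show ?thesis by blast
qed

text \<open>The limits on \<open>C\<close> form an additive set function. It is continuous at the empty set by a compactness
  argument: if \<open>A i\<close> decreases to the empty set and the \<open>K i\<close> are compact subsets of \<open>A i\<close> of almost full
  asymptotic mass, then finitely many \<open>K i\<close> already have empty intersection, so that some \<open>A N\<close> is
  covered by the small sets \<open>A i - K i\<close> with \<open>i < N\<close>. Caratheodory's theorem gives the measure.\<close>

lemma ex_measure_of_setwise_limit:
  fixes \<mu> :: "nat \<Rightarrow> 'b::t2_space measure"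
  assumes \<mu>: "\<And>n. prob_space (\<mu> n)" "\<And>n. sets (\<mu> n) = sets borel"
    and C: "algebra UNIV C" "sigma_sets UNIV C = sets borel"
    and conv: "\<And>A. A \<in> C \<Longrightarrow> convergent (\<lambda>n. measure (\<mu> n) A)"
    and tight: "\<And>A e. A \<in> C \<Longrightarrow> 0 < e \<Longrightarrow>
      \<exists>K. compact K \<and> K \<subseteq> A \<and> (\<forall>\<^sub>F n in sequentially. measure (\<mu> n) (A - K) < e)"
  shows "\<exists>\<nu>. prob_space \<nu> \<and> sets \<nu> = sets borel \<and>
    (\<forall>A\<in>C. (\<lambda>n. measure (\<mu> n) A) \<longlonglongrightarrow> measure \<nu> A)"
proof -
  interpret C: algebra UNIV C by fact
  define v where "v A = lim (\<lambda>n. measure (\<mu> n) A)" for A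
  have v: "(\<lambda>n. measure (\<mu> n) A) \<longlonglongrightarrow> v A" if "A \<in> C" for A
    using conv[OF that] by (simp add: v_def convergent_LIMSEQ_iff)
  have C_borel: "A \<in> sets borel" if "A \<in> C" for A using C(2) that by auto
  have v_nonneg: "0 \<le> v A" if "A \<in> C" for A
    by (rule LIMSEQ_le_const[OF v[OF that]]) simp
  have space: "space (\<mu> n) = UNIV" for n using sets_eq_imp_space_eq[OF \<mu>(2)] by simp
  have "\<exists>m. (\<forall>A\<in>C. m A = ennreal (v A)) \<and> measure_space UNIV (sigma_sets UNIV C) m"
  proof (rule C.caratheodory_empty_continuous)
    have "v {} = 0" using LIMSEQ_unique[OF v[OF C.empty_sets]] by simp
    then show "positive C (\<lambda>A. ennreal (v A))" by (simp add: positive_def)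
    show "additive C (\<lambda>A. ennreal (v A))"
      unfolding additive_def
    proof (intro ballI impI)
      fix A B assume AB: "A \<in> C" "B \<in> C" "A \<inter> B = {}"
      have "measure (\<mu> n) (A \<union> B) = measure (\<mu> n) A + measure (\<mu> n) B" for n
      proof -
        interpret prob_space "\<mu> n" by fact
        show ?thesis using AB C_borel \<mu>(2) by (intro finite_measure_Union) auto
      qed
      then have "(\<lambda>n. measure (\<mu> n) (A \<union> B)) \<longlonglongrightarrow> v A + v B"
        using tendsto_add[OF v[OF AB(1)] v[OF AB(2)]] by simp
      then have "v (A \<union> B) = v A + v B" using LIMSEQ_unique v AB by blast
      then show "ennreal (v (A \<union> B)) = ennreal (v A) + ennreal (v B)"
        using v_nonneg AB by simp
    qed
    fix A :: "nat \<Rightarrow> 'b set" assume A: "range A \<subseteq> C" "decseq A" "(\<Inter>i. A i) = {}"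
    have AC: "A i \<in> C" for i using A(1) by auto
    have v_dec: "v (A j) \<le> v (A i)" if "i \<le> j" for i j
    proof (rule LIMSEQ_le[OF v v])
      show "\<exists>N. \<forall>n\<ge>N. measure (\<mu> n) (A j) \<le> measure (\<mu> n) (A i)"
      proof (intro exI allI impI)
        fix n
        interpret prob_space "\<mu> n" by fact
        show "measure (\<mu> n) (A j) \<le> measure (\<mu> n) (A i)"
          using A(2) that C_borel[OF AC] \<mu>(2) by (intro finite_measure_mono) (auto simp: decseq_def)
      qed
    qed (use AC in auto)
    have "(\<lambda>i. v (A i)) \<longlonglongrightarrow> 0"
    proof (rule LIMSEQ_I)
      fix e :: real assume e: "0 < e"
      \<comment> \<open>The weights \<open>(1 / 2) ^ Suc i\<close> keep the total loss of mass below \<open>e / 2\<close>.\<close>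
      have "\<exists>K. \<forall>i. compact (K i) \<and> K i \<subseteq> A i \<and>
          (\<forall>\<^sub>F n in sequentially. measure (\<mu> n) (A i - K i) < e / 2 * (1 / 2) ^ Suc i)"
        by (intro choice allI tight[OF AC]) (use e in simp)
      then obtain K where K: "\<And>i. compact (K i)" "\<And>i. K i \<subseteq> A i"
        "\<And>i. \<forall>\<^sub>F n in sequentially. measure (\<mu> n) (A i - K i) < e / 2 * (1 / 2) ^ Suc i"
        by blast
      have "(\<Inter>i. K i) = {}" using A(3) K(2) by blast
      then have "K 0 \<inter> (\<Inter>i\<in>UNIV. K i) = {}" by simp
      then have "\<not> (\<forall>I. finite I \<longrightarrow> I \<subseteq> UNIV \<longrightarrow> K 0 \<inter> (\<Inter>i\<in>I. K i) \<noteq> {})"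
        using compact_imp_fip_image[of "K 0" UNIV K, OF K(1) compact_imp_closed[OF K(1)]] by metis
      then obtain I where I: "finite I" "K 0 \<inter> (\<Inter>i\<in>I. K i) = {}" by auto
      obtain N where N: "insert 0 I \<subseteq> {..<N}"
        using I(1) by (metis finite_nat_iff_bounded finite.insertI)
      have bound: "v (A N) \<le> e / 2"
      proof (rule LIMSEQ_le_const2[OF v[OF AC]])
        have "\<forall>\<^sub>F n in sequentially. \<forall>i\<in>{..<N}. measure (\<mu> n) (A i - K i) < e / 2 * (1 / 2) ^ Suc i"
          using K(3) by (intro eventually_ball_finite) auto
        moreover have "measure (\<mu> n) (A N) \<le> e / 2"
          if n: "\<forall>i\<in>{..<N}. measure (\<mu> n) (A i - K i) < e / 2 * (1 / 2) ^ Suc i" for n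
        proof -
          interpret prob_space "\<mu> n" by fact
          have [measurable]: "A i \<in> sets (\<mu> n)" "K i \<in> sets (\<mu> n)" for i
            using C_borel[OF AC] borel_compact[OF K(1)] \<mu>(2) by auto
          have "A N \<subseteq> (\<Union>i\<in>{..<N}. A i - K i)"
          proof
            fix x assume x: "x \<in> A N"
            obtain i where i: "i \<in> insert 0 I" "x \<notin> K i" using I(2) by blast
            then have "i < N" using N by auto
            then have "x \<in> A i" using x A(2) by (auto simp: decseq_def dest: less_imp_le)
            then show "x \<in> (\<Union>i\<in>{..<N}. A i - K i)" using i \<open>i < N\<close> by blast
          qed
          then have "measure (\<mu> n) (A N) \<le> measure (\<mu> n) (\<Union>i\<in>{..<N}. A i - K i)"
            by (intro finite_measure_mono) auto
          also have "\<dots> \<le> (\<Sum>i<N. measure (\<mu> n) (A i - K i))"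
            by (intro finite_measure_subadditive_finite) auto
          also have "\<dots> \<le> (\<Sum>i<N. e / 2 * (1 / 2) ^ Suc i)"
            using n by (intro sum_mono) (auto intro: less_imp_le)
          also have "\<dots> = e / 2 * (\<Sum>i<N. (1 / 2) ^ Suc i)" by (simp add: sum_distrib_left)
          also have "\<dots> \<le> e / 2 * 1"
          proof (rule mult_left_mono)
            have "(\<Sum>i<N. (1 / 2 :: real) ^ Suc i) \<le> (\<Sum>i. (1 / 2) ^ Suc i)"
              using sums_summable[OF power_half_series] by (intro sum_le_suminf) auto
            also have "\<dots> = 1" using power_half_series by (rule sums_unique[symmetric])
            finally show "(\<Sum>i<N. (1 / 2 :: real) ^ Suc i) \<le> 1" .
          qed (use e in simp)
          finally show ?thesis by simp
        qed
        ultimately show "\<exists>N'. \<forall>n\<ge>N'. measure (\<mu> n) (A N) \<le> e / 2"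
          unfolding eventually_sequentially by blast
      qed
      have "norm (v (A n) - 0) < e" if "N \<le> n" for n
        using v_dec[OF that] bound v_nonneg[OF AC, of n] e by simp
      then show "\<exists>N. \<forall>n\<ge>N. norm (v (A n) - 0) < e" by blast
    qed
    then show "(\<lambda>i. ennreal (v (A i))) \<longlonglongrightarrow> 0"
      using tendsto_ennrealI by fastforce
  qed simp
  then obtain m where m: "\<And>A. A \<in> C \<Longrightarrow> m A = ennreal (v A)" "measure_space UNIV (sets borel) m"
    unfolding C(2) by blast
  define \<nu> where "\<nu> = measure_of UNIV (sets borel) m"
  have sets: "sets \<nu> = sets (borel :: 'b measure)"
    unfolding \<nu>_def using sets.sigma_sets_eq[of "borel :: 'b measure"] by (subst sets_measure_of) auto
  have em: "emeasure \<nu> A = m A" if "A \<in> sets borel" for A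
    unfolding \<nu>_def
    using m(2) that by (intro emeasure_measure_of_sigma) (auto simp: measure_space_def)
  have lim: "(\<lambda>n. measure (\<mu> n) A) \<longlonglongrightarrow> measure \<nu> A" if "A \<in> C" for A
    using v[OF that] v_nonneg[OF that] em[OF C_borel[OF that]] m(1)[OF that]
    by (simp add: measure_def)
  have "prob_space \<nu>"
  proof
    have one: "measure (\<mu> n) UNIV = 1" for n
      using prob_space.prob_space[OF \<mu>(1)] space by metis
    have "v UNIV = 1"
      using LIMSEQ_unique[OF v[of UNIV]] C.top by (simp add: one)
    then show "emeasure \<nu> (space \<nu>) = 1"
      using em[of UNIV] m(1)[of UNIV] C.top sets_eq_imp_space_eq[OF sets] by simp
  qed
  then show ?thesis using sets lim by blast
qed

text \<open>Each single law is inner regular. The \<open>j\<close>-th compact set collects, for the laws with index at most \<open>j\<close>,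
  compact subsets that miss less than \<open>1 / (j + 1)\<close> of the mass of \<open>A\<close>.\<close>

lemma ex_compacts_exhausting_mass:
  fixes \<mu> :: "nat \<Rightarrow> 'b::polish_space measure"
  assumes \<mu>: "\<And>n. prob_space (\<mu> n)" "\<And>n. sets (\<mu> n) = sets borel"
    and A: "A \<in> sets borel"
  shows "\<exists>K :: nat \<Rightarrow> 'b set. (\<forall>j. compact (K j) \<and> K j \<subseteq> A) \<and>
    (\<forall>n. (\<lambda>j. measure (\<mu> n) (A - K j)) \<longlonglongrightarrow> 0)"
proof -
  have tight: "\<exists>K. compact K \<and> K \<subseteq> A \<and> measure (\<mu> n) (A - K) < e" if e: "0 < e" for n e
  proof (rule ccontr)
    assume no: "\<not> ?thesis"
    interpret prob_space "\<mu> n" by (rule \<mu>(1))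
    have [measurable]: "A \<in> sets (\<mu> n)" using A \<mu>(2) by simp
    have far: "measure (\<mu> n) K \<le> measure (\<mu> n) A - e" if K: "K \<subseteq> A" "compact K" for K
    proof -
      have [measurable]: "K \<in> sets (\<mu> n)" using borel_compact[OF K(2)] \<mu>(2) by simp
      have "e \<le> measure (\<mu> n) (A - K)" using no K not_le by blast
      also have "\<dots> = measure (\<mu> n) A - measure (\<mu> n) K"
        using K(1) by (intro finite_measure_Diff) auto
      finally show ?thesis by simp
    qed
    have "emeasure (\<mu> n) A = (SUP K \<in> {K. K \<subseteq> A \<and> compact K}. emeasure (\<mu> n) K)"
      by (rule inner_regular) (simp_all add: \<mu>(2) A)
    also have "\<dots> \<le> ennreal (measure (\<mu> n) A - e)"
      using far by (intro SUP_least) (auto simp: emeasure_eq_measure intro: ennreal_leI)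
    finally have "measure (\<mu> n) A \<le> measure (\<mu> n) A - e"
      using far[of "{}"] by (simp add: emeasure_eq_measure)
    then show False using e by simp
  qed
  have "\<exists>C. \<forall>n j. compact (C n j) \<and> C n j \<subseteq> A \<and> measure (\<mu> n) (A - C n j) < inverse (real (Suc j))"
    by (intro choice allI tight) simp
  then obtain C where C: "\<And>n j. compact (C n j)" "\<And>n j. C n j \<subseteq> A"
    "\<And>n j. measure (\<mu> n) (A - C n j) < inverse (real (Suc j))"
    by blast
  define K where "K j = (\<Union>n\<in>{..j}. C n j)" for j
  have compact_K: "compact (K j)" for j unfolding K_def using C(1) by (intro compact_UN) auto
  moreover have "K j \<subseteq> A" for j unfolding K_def using C(2) by auto
  moreover have "(\<lambda>j. measure (\<mu> n) (A - K j)) \<longlonglongrightarrow> 0" for n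
  proof (rule Lim_null_comparison[OF _ LIMSEQ_inverse_real_of_nat])
    interpret prob_space "\<mu> n" by fact
    have [measurable]: "A \<in> sets (\<mu> n)" "C n j \<in> sets (\<mu> n)" "K j \<in> sets (\<mu> n)" for j
      using A borel_compact[OF C(1)] borel_compact[OF compact_K] \<mu>(2) by auto
    have "measure (\<mu> n) (A - K j) \<le> inverse (real (Suc j))" if "n \<le> j" for j
    proof -
      have "measure (\<mu> n) (A - K j) \<le> measure (\<mu> n) (A - C n j)"
        using that by (intro finite_measure_mono) (auto simp: K_def)
      then show ?thesis using C(3)[of n j] by linarith
    qed
    then show "\<forall>\<^sub>F j in sequentially. norm (measure (\<mu> n) (A - K j)) \<le> inverse (real (Suc j))"
      unfolding eventually_sequentially by auto
  qed
  ultimately show ?thesis by blast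
qed

section \<open>Mixtures of i.i.d. laws\<close>

definition iid_law :: "'e::topological_space measure \<Rightarrow> (nat \<Rightarrow> 'e) measure" where
  "iid_law p = PiM UNIV (\<lambda>_. p)"

lemma cylinder_eq_prod_emb:
  fixes A :: "nat \<Rightarrow> 'e::topological_space set"
  shows "prod_emb UNIV (\<lambda>_. borel) J (Pi\<^sub>E J A) = {x. \<forall>j\<in>J. x j \<in> A j}"
  by (auto simp: prod_emb_def PiE_iff)

lemma cylinder_borel:
  fixes A :: "nat \<Rightarrow> 'e::second_countable_topology set"
  assumes "finite J" "\<And>j. j \<in> J \<Longrightarrow> A j \<in> sets borel"
  shows "{x. \<forall>j\<in>J. x j \<in> A j} \<in> sets borel"
  unfolding cylinder_eq_prod_emb[symmetric] sets_PiM_equal_borel[symmetric]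
  using assms by (intro sets_PiM_I) auto

lemma coordinate_borel_measurable:
  "(\<lambda>x :: nat \<Rightarrow> 'e::second_countable_topology. x i) \<in> borel_measurable borel"
  by (intro borel_measurable_continuous_onI continuous_on_product_coordinates)

lemma emeasure_iid_law:
  fixes A :: "nat \<Rightarrow> 'e::second_countable_topology set"
  assumes p: "prob_space p" "sets p = sets borel"
    and J: "finite J" "\<And>j. j \<in> J \<Longrightarrow> A j \<in> sets borel"
  shows "emeasure (iid_law p) {x. \<forall>j\<in>J. x j \<in> A j} = (\<Prod>j\<in>J. emeasure p (A j))"
proof -
  interpret product_prob_space "\<lambda>_::nat. p" UNIV
    using p(1) by (rule product_prob_spaceI)
  have "space p = UNIV" using sets_eq_imp_space_eq[OF p(2)] by simp
  then have "{x. \<forall>j\<in>J. x j \<in> A j} = {x\<in>space (PiM UNIV (\<lambda>_. p)). \<forall>j\<in>J. x j \<in> A j}"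
    by (auto simp: space_PiM)
  then show ?thesis
    unfolding iid_law_def using emeasure_PiM_Collect[of J A] J p(2) by simp
qed

text \<open>On a cylinder the mass of the product measure is a finite product of measurable functions, and
  cylinders generate the Borel sets.\<close>

lemma iid_law_measurable:
  fixes \<alpha> :: "'a \<Rightarrow> 'e::second_countable_topology measure"
  assumes \<alpha>: "\<alpha> \<in> M \<rightarrow>\<^sub>M prob_algebra borel"
  shows "(\<lambda>\<omega>. iid_law (\<alpha> \<omega>)) \<in> M \<rightarrow>\<^sub>M prob_algebra borel"
proof -
  have prob: "prob_space (\<alpha> \<omega>)" "sets (\<alpha> \<omega>) = sets borel" if "\<omega> \<in> space M" for \<omega>
    using measurable_space[OF \<alpha> that] by (auto simp: space_prob_algebra)
  show ?thesis
  proof (rule measurable_prob_algebra_generated)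
    show "sets (borel :: (nat \<Rightarrow> 'e) measure) =
        sigma_sets (\<Pi>\<^sub>E i\<in>UNIV. space (borel :: 'e measure)) (prod_algebra UNIV (\<lambda>_::nat. borel))"
      unfolding sets_PiM_equal_borel[symmetric] by (rule sets_PiM)
    show "Int_stable (prod_algebra UNIV (\<lambda>_::nat. borel :: 'e measure))"
      by (rule Int_stable_prod_algebra)
    show "prod_algebra UNIV (\<lambda>_::nat. borel :: 'e measure) \<subseteq> Pow (\<Pi>\<^sub>E i\<in>UNIV. space borel)"
      by (rule prod_algebra_sets_into_space)
    show "prob_space (iid_law (\<alpha> \<omega>))" if "\<omega> \<in> space M" for \<omega>
      unfolding iid_law_def by (intro prob_space_PiM prob that)
    show "sets (iid_law (\<alpha> \<omega>)) = sets borel" if "\<omega> \<in> space M" for \<omega>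
      unfolding iid_law_def sets_PiM_equal_borel[symmetric] using prob[OF that]
      by (intro sets_PiM_cong) auto
    fix B assume "B \<in> prod_algebra UNIV (\<lambda>_::nat. borel :: 'e measure)"
    then obtain J A where B: "B = prod_emb UNIV (\<lambda>_. borel) J (Pi\<^sub>E J A)"
      and J: "finite J" "\<And>j. j \<in> J \<Longrightarrow> A j \<in> sets (borel :: 'e measure)"
      by (elim prod_algebraE) auto
    have "(\<lambda>\<omega>. \<Prod>j\<in>J. emeasure (\<alpha> \<omega>) (A j)) \<in> borel_measurable M"
      using J(2) measurable_prob_algebraD[OF \<alpha>]
      by (intro borel_measurable_prod_ennreal) (auto intro: measurable_emeasure_kernel)
    then show "(\<lambda>\<omega>. emeasure (iid_law (\<alpha> \<omega>)) B) \<in> borel_measurable M"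
      unfolding B cylinder_eq_prod_emb
      by (subst measurable_cong[OF emeasure_iid_law[OF prob J]]) auto
  qed
qed

definition iid_mixture :: "'a measure \<Rightarrow> ('a \<Rightarrow> 'e::topological_space measure) \<Rightarrow> (nat \<Rightarrow> 'e) measure" where
  "iid_mixture M \<alpha> = M \<bind> (\<lambda>\<omega>. iid_law (\<alpha> \<omega>))"

context
  fixes M :: "'a measure" and \<alpha> :: "'a \<Rightarrow> 'e::second_countable_topology measure"
  assumes M: "prob_space M" and \<alpha>: "\<alpha> \<in> M \<rightarrow>\<^sub>M prob_algebra borel"
begin

interpretation prob_space M by (rule M)

lemma prob_space_iid_mixture: "prob_space (iid_mixture M \<alpha>)"
  unfolding iid_mixture_def by (rule prob_space_bind'[OF _ iid_law_measurable[OF \<alpha>]])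
    (simp add: space_prob_algebra M)

lemma sets_iid_mixture: "sets (iid_mixture M \<alpha>) = sets borel"
  unfolding iid_mixture_def
  using measurable_space[OF iid_law_measurable[OF \<alpha>]] not_empty
  by (intro sets_bind) (auto simp: space_prob_algebra)

lemma space_iid_mixture: "space (iid_mixture M \<alpha>) = UNIV"
  using sets_eq_imp_space_eq[OF sets_iid_mixture] by simp

lemma measure_iid_mixture:
  assumes J: "finite J" "\<And>j. j \<in> J \<Longrightarrow> A j \<in> sets borel"
  shows "measure (iid_mixture M \<alpha>) {x. \<forall>j\<in>J. x j \<in> A j} = (\<integral>\<omega>. (\<Prod>j\<in>J. measure (\<alpha> \<omega>) (A j)) \<partial>M)"
proof -
  have "measure (iid_mixture M \<alpha>) {x. \<forall>j\<in>J. x j \<in> A j} =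
      (\<integral>\<omega>. measure (iid_law (\<alpha> \<omega>)) {x. \<forall>j\<in>J. x j \<in> A j} \<partial>M)"
    unfolding iid_mixture_def
    by (rule measure_bind[OF measurable_prob_algebraD[OF iid_law_measurable[OF \<alpha>]] cylinder_borel[OF J]])
  also have "\<dots> = (\<integral>\<omega>. (\<Prod>j\<in>J. measure (\<alpha> \<omega>) (A j)) \<partial>M)"
  proof (rule Bochner_Integration.integral_cong)
    fix \<omega> assume "\<omega> \<in> space M"
    then have p: "prob_space (\<alpha> \<omega>)" "sets (\<alpha> \<omega>) = sets borel"
      using measurable_space[OF \<alpha>] by (auto simp: space_prob_algebra)
    then interpret p: prob_space "\<alpha> \<omega>" by simp
    have "emeasure (iid_law (\<alpha> \<omega>)) {x. \<forall>j\<in>J. x j \<in> A j} = ennreal (\<Prod>j\<in>J. measure (\<alpha> \<omega>) (A j))"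
      using emeasure_iid_law[OF p J] by (simp add: p.emeasure_eq_measure prod_ennreal)
    then show "measure (iid_law (\<alpha> \<omega>)) {x. \<forall>j\<in>J. x j \<in> A j} = (\<Prod>j\<in>J. measure (\<alpha> \<omega>) (A j))"
      by (simp add: measure_def prod_nonneg)
  qed simp
  finally show ?thesis .
qed

text \<open>A permutation of the coordinates only reindexes the finite product in the formula for cylinders.\<close>

lemma exchangeable_iid_mixture: "exchangeable (iid_mixture M \<alpha>) (\<lambda>i x. x i)"
  unfolding exchangeable_def
proof (intro conjI allI impI)
  show [measurable]: "(\<lambda>x. x i) \<in> borel_measurable (iid_mixture M \<alpha>)" for i
    using coordinate_borel_measurable by (simp cong: measurable_cong_sets add: sets_iid_mixture)
  fix k and \<pi> :: "nat \<Rightarrow> nat" assume \<pi>: "\<pi> permutes {..<k}"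
  let ?N = "iid_mixture M \<alpha>"
  have perm: "(\<lambda>x i. x (\<pi> i)) \<in> borel_measurable ?N" for \<pi> :: "nat \<Rightarrow> nat"
    by (rule measurable_coordinatewise_then_product) simp
  interpret N: prob_space ?N by (rule prob_space_iid_mixture)
  have cyl: "emeasure (distr ?N borel (\<lambda>x i. x (\<pi> i))) {x. \<forall>j\<in>J. x j \<in> A j} =
      (\<integral>\<omega>. (\<Prod>j\<in>J. measure (\<alpha> \<omega>) (A j)) \<partial>M)"
    if J: "finite J" "\<And>j. j \<in> J \<Longrightarrow> A j \<in> sets borel" and \<pi>: "bij \<pi>" for J A and \<pi> :: "nat \<Rightarrow> nat"
  proof -
    have inv: "inv \<pi> (\<pi> j) = j" for j using \<pi> by (simp add: bij_is_inj)
    have "emeasure (distr ?N borel (\<lambda>x i. x (\<pi> i))) {x. \<forall>j\<in>J. x j \<in> A j} =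
        emeasure ?N {x. \<forall>j\<in>J. x (\<pi> j) \<in> A j}"
      by (subst emeasure_distr[OF perm cylinder_borel[OF J]]) (auto simp: space_iid_mixture vimage_def)
    also have "{x. \<forall>j\<in>J. x (\<pi> j) \<in> A j} = {x. \<forall>i\<in>\<pi> ` J. x i \<in> A (inv \<pi> i)}"
      by (simp add: inv)
    also have "emeasure ?N \<dots> = (\<integral>\<omega>. (\<Prod>i\<in>\<pi> ` J. measure (\<alpha> \<omega>) (A (inv \<pi> i))) \<partial>M)"
      unfolding N.emeasure_eq_measure using J by (subst measure_iid_mixture) (auto simp: inv)
    also have "\<dots> = (\<integral>\<omega>. (\<Prod>j\<in>J. measure (\<alpha> \<omega>) (A j)) \<partial>M)"
      using \<pi> by (subst prod.reindex) (auto simp: inv bij_is_inj inj_on_def dest: bij_is_inj injD)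
    finally show ?thesis .
  qed
  show "distr ?N borel (\<lambda>x i. x (\<pi> i)) = distr ?N borel (\<lambda>x i. x i)"
  proof (rule measure_eqI_PiM_infinite)
    show "sets (distr ?N borel (\<lambda>x i. x (\<pi> i))) = sets (PiM UNIV (\<lambda>_::nat. borel :: 'e measure))"
      "sets (distr ?N borel (\<lambda>x i. x i)) = sets (PiM UNIV (\<lambda>_::nat. borel :: 'e measure))"
      by (simp_all add: sets_PiM_equal_borel)
    show "finite_measure (distr ?N borel (\<lambda>x i. x (\<pi> i)))"
      by (intro prob_space.finite_measure N.prob_space_distr perm)
    fix A :: "nat \<Rightarrow> 'e set" and J :: "nat set"
    assume J: "finite J" "\<And>i. i \<in> J \<Longrightarrow> A i \<in> sets borel"
    show "emeasure (distr ?N borel (\<lambda>x i. x (\<pi> i))) (prod_emb UNIV (\<lambda>_. borel) J (Pi\<^sub>E J A)) =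
        emeasure (distr ?N borel (\<lambda>x i. x i)) (prod_emb UNIV (\<lambda>_. borel) J (Pi\<^sub>E J A))"
      unfolding cylinder_eq_prod_emb
      using cyl[OF J permutes_bij[OF \<pi>]] cyl[OF J bij_id] by simp
  qed
qed

lemma directed_by_iid_mixture: "directed_by (iid_mixture M \<alpha>) (\<lambda>i x. x i) M \<alpha>"
  unfolding directed_by_def
proof (intro allI impI)
  fix k :: nat and A :: "nat \<Rightarrow> 'e set" assume A: "\<forall>j<k. A j \<in> sets borel"
  show "measure (iid_mixture M \<alpha>) {x\<in>space (iid_mixture M \<alpha>). \<forall>j<k. x j \<in> A j} =
      (\<integral>\<omega>. (\<Prod>j<k. measure (\<alpha> \<omega>) (A j)) \<partial>M)"
    using measure_iid_mixture[of "{..<k}" A] A by (simp add: space_iid_mixture Ball_def)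
qed

end

definition cylinders :: "'e set set \<Rightarrow> (nat \<Rightarrow> 'e) set set" where
  "cylinders C = {{x. \<forall>j<k. x j \<in> A j} | (k::nat) A. \<forall>j. A j \<in> C}"

lemma cylindersI: "(\<And>j. A j \<in> C) \<Longrightarrow> {x. \<forall>j<k. x j \<in> A j} \<in> cylinders C"
  unfolding cylinders_def by blast

lemma cylindersE:
  assumes "B \<in> cylinders C"
  obtains k A where "B = {x. \<forall>j<k. x j \<in> A j}" "\<forall>j. A j \<in> C"
  using assms unfolding cylinders_def by blast

lemma cylinders_borel:
  fixes C :: "'e::second_countable_topology set set"
  assumes "C \<subseteq> sets borel"
  shows "cylinders C \<subseteq> sets borel"
proof
  fix B assume "B \<in> cylinders C"
  then obtain k A where B: "B = {x. \<forall>j<k. x j \<in> A j}" "\<forall>j. A j \<in> C" by (rule cylindersE)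
  have "A j \<in> sets borel" for j using B(2) assms by blast
  then show "B \<in> sets borel"
    unfolding B(1) using cylinder_borel[of "{..<k}" A] by simp
qed

lemma cylinders_Int:
  assumes C: "UNIV \<in> C" "\<And>A A'. A \<in> C \<Longrightarrow> A' \<in> C \<Longrightarrow> A \<inter> A' \<in> C"
    and B: "B \<in> cylinders C" "B' \<in> cylinders C"
  shows "B \<inter> B' \<in> cylinders C"
proof -
  from B(1) obtain k A where k: "B = {x. \<forall>j<k. x j \<in> A j}" "\<forall>j. A j \<in> C" by (rule cylindersE)
  from B(2) obtain k' A' where k': "B' = {x. \<forall>j<k'. x j \<in> A' j}" "\<forall>j. A' j \<in> C" by (rule cylindersE)
  define D where "D j = (if j < k then A j else UNIV) \<inter> (if j < k' then A' j else UNIV)" for j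
  have "B \<inter> B' = {x. \<forall>j<max k k'. x j \<in> D j}"
  proof (intro set_eqI iffI)
    fix x assume "x \<in> B \<inter> B'"
    then show "x \<in> {x. \<forall>j<max k k'. x j \<in> D j}" by (simp add: k(1) k'(1) D_def)
  next
    fix x assume "x \<in> {x. \<forall>j<max k k'. x j \<in> D j}"
    then have x: "x j \<in> D j" if "j < k \<or> j < k'" for j
      using that by (auto simp: less_max_iff_disj)
    have "x j \<in> A j" if "j < k" for j using x[of j] that by (simp add: D_def)
    moreover have "x j \<in> A' j" if "j < k'" for j using x[of j] that by (simp add: D_def)
    ultimately show "x \<in> B \<inter> B'" by (simp add: k(1) k'(1))
  qed
  moreover have "D j \<in> C" for j
  proof -
    have "(if j < k then A j else UNIV) \<in> C" "(if j < k' then A' j else UNIV) \<in> C"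
      using k(2) k'(2) C(1) by simp_all
    then show ?thesis unfolding D_def by (rule C(2))
  qed
  ultimately show ?thesis using cylindersI[of D C "max k k'"] by simp
qed

text \<open>Boxes with basic open sides in the first \<open>k\<close> coordinates form a countable basis of the product
  topology; they are coded by lists of natural numbers.\<close>

lemma cylinders_exhaust_open:
  fixes U :: "nat \<Rightarrow> 'e::second_countable_topology set" and W :: "(nat \<Rightarrow> 'e) set"
  assumes U: "topological_basis (range U)" and W: "open W"
    and C: "range U \<subseteq> C" "{} \<in> C"
  shows "\<exists>B :: nat \<Rightarrow> (nat \<Rightarrow> 'e) set. range B \<subseteq> cylinders C \<and> W = (\<Union>i. B i)"
proof -
  define cyl where "cyl s = {x. \<forall>j<length s. x j \<in> U (s ! j)}" for s :: "nat list"
  have cyl: "cyl s \<in> cylinders C" for s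
    unfolding cyl_def using C(1) by (intro cylindersI) auto
  have nbhd: "\<exists>s. x \<in> cyl s \<and> cyl s \<subseteq> W" if x: "x \<in> W" for x
  proof -
    obtain V where V: "x \<in> Pi\<^sub>E UNIV V" "\<And>i. open (V i)" "finite {i. V i \<noteq> UNIV}" "Pi\<^sub>E UNIV V \<subseteq> W"
      using product_topology_open_contains_basis[OF W[unfolded open_fun_def] x] by auto
    obtain k where k: "{i. V i \<noteq> UNIV} \<subseteq> {..<k}" using V(3) finite_nat_iff_bounded by blast
    have "\<exists>f. \<forall>j. x j \<in> U (f j) \<and> U (f j) \<subseteq> V j"
    proof (intro choice allI)
      fix j
      have "x j \<in> V j" using V(1) by (auto simp: PiE_iff)
      then show "\<exists>i. x j \<in> U i \<and> U i \<subseteq> V j"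
        using topological_basisE[OF U V(2)] by blast
    qed
    then obtain f where f: "\<And>j. x j \<in> U (f j)" "\<And>j. U (f j) \<subseteq> V j" by blast
    have "cyl (map f [0..<k]) \<subseteq> Pi\<^sub>E UNIV V"
      using f(2) k unfolding cyl_def by (auto simp: PiE_iff) blast
    moreover have "x \<in> cyl (map f [0..<k])" using f(1) by (simp add: cyl_def)
    ultimately show ?thesis using V(4) by blast
  qed
  have "{x. \<forall>j<Suc 0. x j \<in> {}} = ({} :: (nat \<Rightarrow> 'e) set)" by auto
  then have empty: "{} \<in> cylinders C"
    using cylindersI[of "\<lambda>_. {}" C "Suc 0", OF C(2)] by metis
  define B where "B i = (if cyl (from_nat i) \<subseteq> W then cyl (from_nat i) else {})" for i
  have "B i \<in> cylinders C" for i
    unfolding B_def by (split if_split) (intro conjI impI cyl empty)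
  then have B: "range B \<subseteq> cylinders C" by (rule image_subsetI)
  have "W = (\<Union>i. B i)"
  proof (intro set_eqI iffI)
    fix x assume "x \<in> W"
    then obtain s where "x \<in> cyl s" "cyl s \<subseteq> W" using nbhd by blast
    then have "x \<in> B (to_nat s)" by (simp add: B_def)
    then show "x \<in> (\<Union>i. B i)" by (rule UN_I[OF UNIV_I])
  next
    fix x assume "x \<in> (\<Union>i. B i)"
    then obtain i where "x \<in> B i" by (rule UN_E)
    then show "x \<in> W" by (auto simp: B_def split: if_splits)
  qed
  with B show ?thesis by (intro exI[of _ B] conjI)
qed

section \<open>Predictive distributions and finite-dimensional laws\<close>

locale predictive_sequence = filtered_prob_space +
  fixes X :: "nat \<Rightarrow> 'a \<Rightarrow> 'e::topological_space" and \<alpha> :: "nat \<Rightarrow> 'a \<Rightarrow> 'e measure"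
  assumes X_adapted: "\<And>n. 1 \<le> n \<Longrightarrow> X n \<in> borel_measurable (G n)"
    and predictive: "\<And>n. regular_cond_distribution M (G n) (X (n + 1)) (\<alpha> n)"
begin

lemma X_measurable: "1 \<le> n \<Longrightarrow> X n \<in> borel_measurable M"
  by (rule adapted_measurable[OF X_adapted])

lemma \<alpha>_kernel: "\<alpha> n \<in> G n \<rightarrow>\<^sub>M prob_algebra borel"
  using predictive by (simp add: regular_cond_distribution_def)

lemma \<alpha>_prob:
  assumes "\<omega> \<in> space M"
  shows "prob_space (\<alpha> n \<omega>)" "sets (\<alpha> n \<omega>) = sets borel"
  using measurable_space[OF \<alpha>_kernel, of \<omega> n] assms by (auto simp: space_prob_algebra)

lemma \<alpha>_range:
  assumes "\<omega> \<in> space M"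
  shows "0 \<le> measure (\<alpha> n \<omega>) A \<and> measure (\<alpha> n \<omega>) A \<le> 1"
  using prob_space.prob_le_1[OF \<alpha>_prob(1)[OF assms]] by simp

lemma \<alpha>_adapted:
  assumes "A \<in> sets borel"
  shows "(\<lambda>\<omega>. measure (\<alpha> n \<omega>) A) \<in> borel_measurable (G n)"
  by (rule measurable_compose[OF measurable_prob_algebraD[OF \<alpha>_kernel]
      measurable_measure_subprob_algebra[OF assms]])

lemma \<alpha>_measurable:
  "A \<in> sets borel \<Longrightarrow> (\<lambda>\<omega>. measure (\<alpha> n \<omega>) A) \<in> borel_measurable M"
  by (rule adapted_measurable[OF \<alpha>_adapted])

lemma indicator_X_measurable:
  assumes "1 \<le> n" "A \<in> sets borel"
  shows "(\<lambda>\<omega>. indicat_real A (X n \<omega>)) \<in> borel_measurable (G n)"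
  using X_adapted[OF assms(1)] assms(2) by measurable

lemma predict_next:
  assumes Z: "Z \<in> borel_measurable (G n)" "\<And>\<omega>. \<omega> \<in> space M \<Longrightarrow> \<bar>Z \<omega>\<bar> \<le> 1" and A: "A \<in> sets borel"
  shows "(\<integral>\<omega>. Z \<omega> * indicat_real A (X (Suc n) \<omega>) \<partial>M) = (\<integral>\<omega>. Z \<omega> * measure (\<alpha> n \<omega>) A \<partial>M)"
proof -
  interpret G: sigma_finite_subalgebra M "G n" by (rule sigma_finite_G)
  have ind: "(\<lambda>\<omega>. indicat_real A (X (Suc n) \<omega>)) \<in> borel_measurable M"
    by (rule adapted_measurable[OF indicator_X_measurable[OF _ A]]) simp
  have Z_M: "Z \<in> borel_measurable M" by (rule adapted_measurable[OF Z(1)])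
  have int: "integrable M (\<lambda>\<omega>. Z \<omega> * indicat_real A (X (Suc n) \<omega>))"
    by (rule integrable_bounded[where B = 1])
      (use ind Z_M Z(2) in \<open>auto simp: abs_mult indicator_def\<close>)
  have "(\<integral>\<omega>. Z \<omega> * indicat_real A (X (Suc n) \<omega>) \<partial>M) =
      (\<integral>\<omega>. Z \<omega> * cond_prob_in M (G n) (X (Suc n)) A \<omega> \<partial>M)"
    unfolding cond_prob_in_def by (rule G.real_cond_exp_intg(2)[OF int Z(1) ind, symmetric])
  also have "\<dots> = (\<integral>\<omega>. Z \<omega> * measure (\<alpha> n \<omega>) A \<partial>M)"
  proof (rule integral_cong_AE)
    show "AE \<omega> in M. Z \<omega> * cond_prob_in M (G n) (X (Suc n)) A \<omega> = Z \<omega> * measure (\<alpha> n \<omega>) A"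
      using predictive[of n] A unfolding regular_cond_distribution_def by auto
  qed (use Z_M \<alpha>_measurable[OF A] in \<open>auto simp: cond_prob_in_def\<close>)
  finally show ?thesis .
qed

lemma expectation_\<alpha>:
  assumes A: "A \<in> sets borel"
  shows "(\<integral>\<omega>. measure (\<alpha> n \<omega>) A \<partial>M) = measure (distr M borel (X (Suc n))) A"
proof -
  have "measure (distr M borel (X (Suc n))) A = measure M (X (Suc n) -` A \<inter> space M)"
    by (rule measure_distr[OF X_measurable A]) simp
  also have "\<dots> = (\<integral>\<omega>. indicat_real A (X (Suc n) \<omega>) \<partial>M)"
  proof -
    have "(\<integral>\<omega>. indicat_real A (X (Suc n) \<omega>) \<partial>M) = (\<integral>\<omega>. indicat_real (X (Suc n) -` A \<inter> space M) \<omega> \<partial>M)"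
      by (intro Bochner_Integration.integral_cong) (auto simp: indicator_def)
    then show ?thesis using measurable_sets[OF X_measurable A, of "Suc n"] by simp
  qed
  also have "\<dots> = (\<integral>\<omega>. measure (\<alpha> n \<omega>) A \<partial>M)"
    using predict_next[of "\<lambda>_. 1" n A] A by simp
  finally show ?thesis by simp
qed

text \<open>By induction on \<open>k\<close>, with a general weight \<open>W n\<close> known at time \<open>n\<close>. Conditioning on time \<open>n + k\<close> turns
  the last indicator into \<open>\<alpha> (n + k) (A k)\<close>. This differs from \<open>\<alpha> n (A k)\<close> by an error that vanishes in
  mean, because both converge to the same limit, and \<open>\<alpha> n (A k)\<close> is known at time \<open>n\<close>, so it can be
  absorbed into the weight.\<close>

lemma cylinder_expectation_tendsto:
  fixes A :: "nat \<Rightarrow> 'e set" and \<beta> :: "'a \<Rightarrow> 'e measure"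
  assumes A: "\<And>j. A j \<in> sets borel"
    and \<beta>: "\<And>j. (\<lambda>\<omega>. measure (\<beta> \<omega>) (A j)) \<in> borel_measurable M"
    and lim: "\<And>j. AE \<omega> in M. (\<lambda>n. measure (\<alpha> n \<omega>) (A j)) \<longlonglongrightarrow> measure (\<beta> \<omega>) (A j)"
    and W: "\<And>n. W n \<in> borel_measurable (G n)" "\<And>n \<omega>. \<omega> \<in> space M \<Longrightarrow> \<bar>W n \<omega>\<bar> \<le> 1"
    and V: "V \<in> borel_measurable M" "AE \<omega> in M. (\<lambda>n. W n \<omega>) \<longlonglongrightarrow> V \<omega>"
  shows "(\<lambda>n. \<integral>\<omega>. W n \<omega> * (\<Prod>j<k. indicat_real (A j) (X (Suc (n + j)) \<omega>)) \<partial>M)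
    \<longlonglongrightarrow> (\<integral>\<omega>. V \<omega> * (\<Prod>j<k. measure (\<beta> \<omega>) (A j)) \<partial>M)"
  using W V
proof (induction k arbitrary: W V)
  case 0
  have "(\<lambda>n. \<integral>\<omega>. W n \<omega> \<partial>M) \<longlonglongrightarrow> (\<integral>\<omega>. V \<omega> \<partial>M)"
    by (rule integral_dominated_convergence[where w = "\<lambda>_. 1"])
      (use 0 adapted_measurable[OF 0(1)] in auto)
  then show ?case by simp
next
  case (Suc k)
  define P where "P n \<omega> = W n \<omega> * (\<Prod>j<k. indicat_real (A j) (X (Suc (n + j)) \<omega>))" for n \<omega>
  define a where "a n \<omega> = measure (\<alpha> n \<omega>) (A k)" for n \<omega>
  have P_adapted: "P n \<in> borel_measurable (G (n + k))" for n
    unfolding P_def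
    by (intro borel_measurable_times borel_measurable_prod measurable_G_mono[OF _ Suc.prems(1)]
        measurable_G_mono[OF _ indicator_X_measurable[OF _ A]]) auto
  have P_bound: "\<bar>P n \<omega>\<bar> \<le> 1" if "\<omega> \<in> space M" for n \<omega>
  proof -
    have "\<bar>\<Prod>j<k. indicat_real (A j) (X (Suc (n + j)) \<omega>)\<bar> \<le> 1"
      unfolding abs_prod by (intro prod_le_1) (auto simp: indicator_def)
    then show ?thesis
      unfolding P_def abs_mult using Suc.prems(2)[OF that] by (intro mult_le_one) auto
  qed
  have [measurable]: "P n \<in> borel_measurable M" "a n \<in> borel_measurable M" for n
    unfolding a_def by (rule adapted_measurable[OF P_adapted], rule \<alpha>_measurable[OF A])
  have a_range: "0 \<le> a n \<omega>" "a n \<omega> \<le> 1" if "\<omega> \<in> space M" for n \<omega>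
    using \<alpha>_range[OF that] by (auto simp: a_def)
  have Pa_int: "integrable M (\<lambda>\<omega>. P n \<omega> * a m \<omega>)" for n m
    by (rule integrable_bounded[where B = 1])
      (use P_bound a_range in \<open>auto simp: abs_mult intro!: mult_le_one\<close>)
  have last: "(\<integral>\<omega>. W n \<omega> * (\<Prod>j<Suc k. indicat_real (A j) (X (Suc (n + j)) \<omega>)) \<partial>M) =
      (\<integral>\<omega>. P n \<omega> * a n \<omega> \<partial>M) + (\<integral>\<omega>. P n \<omega> * (a (n + k) \<omega> - a n \<omega>) \<partial>M)" for n
  proof -
    have "(\<integral>\<omega>. W n \<omega> * (\<Prod>j<Suc k. indicat_real (A j) (X (Suc (n + j)) \<omega>)) \<partial>M) =
        (\<integral>\<omega>. P n \<omega> * indicat_real (A k) (X (Suc (n + k)) \<omega>) \<partial>M)"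
      by (simp add: P_def mult.assoc)
    also have "\<dots> = (\<integral>\<omega>. P n \<omega> * a (n + k) \<omega> \<partial>M)"
      unfolding a_def by (rule predict_next[OF P_adapted P_bound A])
    also have "\<dots> = (\<integral>\<omega>. P n \<omega> * a n \<omega> \<partial>M) + (\<integral>\<omega>. P n \<omega> * (a (n + k) \<omega> - a n \<omega>) \<partial>M)"
      using Pa_int by (simp add: right_diff_distrib)
    finally show ?thesis .
  qed
  have error: "(\<lambda>n. \<integral>\<omega>. P n \<omega> * (a (n + k) \<omega> - a n \<omega>) \<partial>M) \<longlonglongrightarrow> (\<integral>\<omega>. 0 \<partial>M)"
  proof (rule integral_dominated_convergence[where w = "\<lambda>_. 1"])
    show "AE \<omega> in M. (\<lambda>n. P n \<omega> * (a (n + k) \<omega> - a n \<omega>)) \<longlonglongrightarrow> 0"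
      using lim[of k] AE_space
    proof eventually_elim
      case (elim \<omega>)
      have "(\<lambda>n. a n \<omega>) \<longlonglongrightarrow> measure (\<beta> \<omega>) (A k)" using elim(1) by (simp add: a_def)
      from tendsto_diff[OF LIMSEQ_ignore_initial_segment[OF this, of k] this]
      have "(\<lambda>n. \<bar>a (n + k) \<omega> - a n \<omega>\<bar>) \<longlonglongrightarrow> 0" by (simp add: tendsto_rabs_zero)
      then show ?case
      proof (rule Lim_null_comparison[rotated], intro always_eventually allI)
        fix n
        show "norm (P n \<omega> * (a (n + k) \<omega> - a n \<omega>)) \<le> \<bar>a (n + k) \<omega> - a n \<omega>\<bar>"
          using P_bound[OF elim(2), of n] by (simp add: abs_mult mult_left_le_one_le)
      qed
    qed
    show "AE \<omega> in M. norm (P n \<omega> * (a (n + k) \<omega> - a n \<omega>)) \<le> 1" for n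
    proof (rule AE_I2)
      fix \<omega> assume w: "\<omega> \<in> space M"
      have "\<bar>a (n + k) \<omega> - a n \<omega>\<bar> \<le> 1"
        using a_range[OF w, of n] a_range[OF w, of "n + k"] by linarith
      then show "norm (P n \<omega> * (a (n + k) \<omega> - a n \<omega>)) \<le> 1"
        using P_bound[OF w, of n] by (simp add: abs_mult mult_le_one)
    qed
  qed auto
  have main: "(\<lambda>n. \<integral>\<omega>. W n \<omega> * a n \<omega> * (\<Prod>j<k. indicat_real (A j) (X (Suc (n + j)) \<omega>)) \<partial>M)
    \<longlonglongrightarrow> (\<integral>\<omega>. V \<omega> * measure (\<beta> \<omega>) (A k) * (\<Prod>j<k. measure (\<beta> \<omega>) (A j)) \<partial>M)"
  proof (rule Suc.IH)
    show "(\<lambda>\<omega>. W n \<omega> * a n \<omega>) \<in> borel_measurable (G n)" for n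
      unfolding a_def by (intro borel_measurable_times Suc.prems \<alpha>_adapted A)
    show "\<bar>W n \<omega> * a n \<omega>\<bar> \<le> 1" if "\<omega> \<in> space M" for n \<omega>
      using Suc.prems(2)[OF that, of n] a_range[OF that, of n] by (simp add: abs_mult mult_le_one)
    show "(\<lambda>\<omega>. V \<omega> * measure (\<beta> \<omega>) (A k)) \<in> borel_measurable M"
      by (intro borel_measurable_times Suc.prems \<beta>)
    show "AE \<omega> in M. (\<lambda>n. W n \<omega> * a n \<omega>) \<longlonglongrightarrow> V \<omega> * measure (\<beta> \<omega>) (A k)"
      using Suc.prems(4) lim[of k] unfolding a_def by eventually_elim (rule tendsto_mult)
  qed
  have "(\<integral>\<omega>. W n \<omega> * a n \<omega> * (\<Prod>j<k. indicat_real (A j) (X (Suc (n + j)) \<omega>)) \<partial>M) =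
      (\<integral>\<omega>. P n \<omega> * a n \<omega> \<partial>M)" for n
    by (simp add: P_def mult.assoc mult.left_commute mult.commute)
  then show ?case
    unfolding last using tendsto_add[OF main error] by (simp add: mult.assoc mult.commute)
qed

end

section \<open>Almost conditionally identically distributed sequences\<close>

locale acid_sequence = summable_drift M G \<xi> + predictive_sequence M G X \<alpha>
  for M :: "'a measure" and G \<xi> and X :: "nat \<Rightarrow> 'a \<Rightarrow> 'e::polish_space" and \<alpha> +
  assumes acid: "acid M G \<xi> X"
begin

lemma predictive_drift_upper:
  assumes A: "A \<in> sets borel"
  shows "AE \<omega> in M. real_cond_exp M (G n) (\<lambda>\<omega>. measure (\<alpha> (Suc n) \<omega>) A) \<omega> \<le> measure (\<alpha> n \<omega>) A + \<xi> n \<omega>"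
proof -
  interpret G: sigma_finite_subalgebra M "G n" by (rule sigma_finite_G)
  have pred: "AE \<omega> in M. measure (\<alpha> m \<omega>) A = cond_prob_in M (G m) (X (m + 1)) A \<omega>" for m
    using predictive A by (simp add: regular_cond_distribution_def)
  have "AE \<omega> in M. real_cond_exp M (G n) (\<lambda>\<omega>. measure (\<alpha> (Suc n) \<omega>) A) \<omega> =
      real_cond_exp M (G n) (cond_prob_in M (G (n + 1)) (X (n + 2)) A) \<omega>"
    by (rule G.real_cond_exp_cong) (use pred[of "Suc n"] \<alpha>_measurable[OF A] in \<open>simp_all add: cond_prob_in_def\<close>)
  moreover have "AE \<omega> in M. real_cond_exp M (G n) (cond_prob_in M (G (n + 1)) (X (n + 2)) A) \<omega>
          \<le> cond_prob_in M (G n) (X (n + 1)) A \<omega> + \<xi> n \<omega>"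
    using acid A unfolding acid_def by blast
  ultimately show ?thesis using pred[of n] by eventually_elim simp
qed

text \<open>The a.c.i.d. condition bounds the upward drift of the predictive probability of \<open>A\<close>; applied to the
  complement of \<open>A\<close> it bounds the downward drift as well.\<close>

lemma almost_martingale_predictive:
  assumes A: "A \<in> sets borel"
  shows "almost_martingale M G \<xi> (\<lambda>n \<omega>. measure (\<alpha> n \<omega>) A)"
proof (intro almost_martingale.intro almost_martingale_axioms.intro summable_drift_axioms)
  fix n
  interpret G: sigma_finite_subalgebra M "G n" by (rule sigma_finite_G)
  let ?Y = "\<lambda>\<omega>. measure (\<alpha> (Suc n) \<omega>) A"
  have A': "- A \<in> sets borel" using A by (rule borel_comp)
  have compl: "measure (\<alpha> m \<omega>) (- A) = 1 - measure (\<alpha> m \<omega>) A" if "\<omega> \<in> space M" for m \<omega>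
    using prob_space.prob_compl[OF \<alpha>_prob(1)[OF that], of A m] \<alpha>_prob(2)[OF that, of m] A
      sets_eq_imp_space_eq[OF \<alpha>_prob(2)[OF that, of m]] by (simp add: Compl_eq_Diff_UNIV)
  have Y_int: "integrable M ?Y"
    by (rule integrable_bounded[where B = 1]) (use \<alpha>_measurable[OF A] \<alpha>_range in auto)
  have "AE \<omega> in M. real_cond_exp M (G n) (\<lambda>\<omega>. measure (\<alpha> (Suc n) \<omega>) (- A)) \<omega> =
      real_cond_exp M (G n) (\<lambda>\<omega>. 1 - ?Y \<omega>) \<omega>"
    by (rule G.real_cond_exp_cong) (use \<alpha>_measurable[OF A] \<alpha>_measurable[OF A'] compl in auto)
  moreover have "AE \<omega> in M. real_cond_exp M (G n) (\<lambda>\<omega>. 1 - ?Y \<omega>) \<omega> =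
      real_cond_exp M (G n) (\<lambda>_. 1) \<omega> - real_cond_exp M (G n) ?Y \<omega>"
    by (rule G.real_cond_exp_diff) (use Y_int in auto)
  moreover have "AE \<omega> in M. real_cond_exp M (G n) (\<lambda>_. 1) \<omega> = 1"
    by (rule G.real_cond_exp_F_meas) auto
  ultimately show "AE \<omega> in M. \<bar>real_cond_exp M (G n) ?Y \<omega> - measure (\<alpha> n \<omega>) A\<bar> \<le> \<xi> n \<omega>"
    using predictive_drift_upper[OF A, of n] predictive_drift_upper[OF A', of n] AE_space
    by eventually_elim (use compl in \<open>auto simp: abs_le_iff\<close>)
qed (use \<alpha>_adapted[OF A] \<alpha>_range in auto)

text \<open>Choose compact sets \<open>K j \<subseteq> A\<close> that exhaust the mass of \<open>A\<close> for the laws of all \<open>X n\<close>. The predictive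
  probabilities of \<open>A - K j\<close> are almost martingales whose expectations vanish as \<open>j\<close> grows.\<close>

lemma AE_predictive_tight:
  assumes A: "A \<in> sets borel"
  shows "AE \<omega> in M. \<forall>e>0. \<exists>K. compact K \<and> K \<subseteq> A \<and>
    (\<forall>\<^sub>F n in sequentially. measure (\<alpha> n \<omega>) (A - K) < e)"
proof -
  have X: "X (Suc n) \<in> borel_measurable M" for n by (rule X_measurable) simp
  have "\<exists>K :: nat \<Rightarrow> 'e set. (\<forall>j. compact (K j) \<and> K j \<subseteq> A) \<and>
      (\<forall>n. (\<lambda>j. measure (distr M borel (X (Suc n))) (A - K j)) \<longlonglongrightarrow> 0)"
    by (rule ex_compacts_exhausting_mass[OF prob_space_distr[OF X] sets_distr A])
  then obtain K :: "nat \<Rightarrow> 'e set" where K: "\<And>j. compact (K j)" "\<And>j. K j \<subseteq> A"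
    "\<And>n. (\<lambda>j. measure (distr M borel (X (Suc n))) (A - K j)) \<longlonglongrightarrow> 0"
    by blast
  have AK: "A - K j \<in> sets borel" for j using A borel_compact[OF K(1)] by blast
  have "AE \<omega> in M. \<forall>e>0. \<exists>j. \<forall>\<^sub>F n in sequentially. measure (\<alpha> n \<omega>) (A - K j) < e"
  proof (rule AE_limits_vanish[OF almost_martingale_predictive[OF AK]])
    show "(\<lambda>j. \<integral>\<omega>. measure (\<alpha> m \<omega>) (A - K j) \<partial>M) \<longlonglongrightarrow> 0" for m
      unfolding expectation_\<alpha>[OF AK] by (rule K(3))
  qed
  then show ?thesis
  proof eventually_elim
    case (elim \<omega>)
    show ?case
    proof (intro allI impI)
      fix e :: real assume "0 < e"
      then obtain j where "\<forall>\<^sub>F n in sequentially. measure (\<alpha> n \<omega>) (A - K j) < e"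
        using elim by blast
      then show "\<exists>K. compact K \<and> K \<subseteq> A \<and> (\<forall>\<^sub>F n in sequentially. measure (\<alpha> n \<omega>) (A - K) < e)"
        using K(1,2) by (intro exI[of _ "K j"] conjI)
    qed
  qed
qed

text \<open>Countably many sets are involved, so one null set serves them all. There the limit is replaced by
  \<open>\<alpha> 0\<close>, which keeps the kernel measurable with probability measures as values.\<close>

lemma ex_setwise_limit_kernel:
  fixes U :: "nat \<Rightarrow> 'e set"
  assumes U: "topological_basis (range U)"
  shows "\<exists>\<beta>. \<beta> \<in> M \<rightarrow>\<^sub>M prob_algebra borel \<and>
    (AE \<omega> in M. \<forall>A\<in>countable_algebra U. (\<lambda>n. measure (\<alpha> n \<omega>) A) \<longlonglongrightarrow> measure (\<beta> \<omega>) A)"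
proof -
  let ?C = "countable_algebra U"
  interpret C: algebra UNIV ?C by (rule algebra_countable_algebra)
  have C_borel: "A \<in> sets borel" if "A \<in> ?C" for A
    using sigma_sets_countable_algebra[OF U] that by auto
  define limit where "limit \<omega> \<nu> \<longleftrightarrow> prob_space \<nu> \<and> sets \<nu> = sets borel \<and>
    (\<forall>A\<in>?C. (\<lambda>n. measure (\<alpha> n \<omega>) A) \<longlonglongrightarrow> measure \<nu> A)" for \<omega> and \<nu> :: "'e measure"
  have "AE \<omega> in M. \<forall>A\<in>?C. convergent (\<lambda>n. measure (\<alpha> n \<omega>) A)"
    using C_borel almost_martingale.AE_convergent[OF almost_martingale_predictive]
    by (subst AE_ball_countable[OF countable_countable_algebra]) auto
  moreover have "AE \<omega> in M. \<forall>A\<in>?C. \<forall>e>0. \<exists>K. compact K \<and> K \<subseteq> A \<and>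
      (\<forall>\<^sub>F n in sequentially. measure (\<alpha> n \<omega>) (A - K) < e)"
    using C_borel AE_predictive_tight
    by (subst AE_ball_countable[OF countable_countable_algebra]) auto
  ultimately have "AE \<omega> in M. \<exists>\<nu>. limit \<omega> \<nu>"
    using AE_space
  proof eventually_elim
    case (elim \<omega>)
    show ?case unfolding limit_def
      by (rule ex_measure_of_setwise_limit[OF \<alpha>_prob[OF elim(3)] algebra_countable_algebra
            sigma_sets_countable_algebra[OF U]]) (use elim in auto)
  qed
  then obtain N where N: "N \<in> null_sets M" "{\<omega>\<in>space M. \<not> (\<exists>\<nu>. limit \<omega> \<nu>)} \<subseteq> N"
    by (auto simp: eventually_ae_filter)
  have [measurable]: "N \<in> sets M" using N(1) by auto
  define \<beta> where "\<beta> \<omega> = (if \<omega> \<in> N then \<alpha> 0 \<omega> else (SOME \<nu>. limit \<omega> \<nu>))" for \<omega>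
  have limit_\<beta>: "limit \<omega> (\<beta> \<omega>)" if "\<omega> \<in> space M" "\<omega> \<notin> N" for \<omega>
  proof -
    have "\<exists>\<nu>. limit \<omega> \<nu>" using N(2) that by blast
    then show ?thesis unfolding \<beta>_def using that(2) by (simp add: someI_ex)
  qed
  have \<beta>_prob: "prob_space (\<beta> \<omega>)" "sets (\<beta> \<omega>) = sets borel" if "\<omega> \<in> space M" for \<omega>
    using limit_\<beta>[OF that] \<alpha>_prob[OF that, of 0]
    by (cases "\<omega> \<in> N"; simp add: \<beta>_def limit_def)+
  have "\<beta> \<in> M \<rightarrow>\<^sub>M prob_algebra borel"
  proof (rule measurable_prob_algebra_generated[OF sigma_sets_countable_algebra[OF U, symmetric]])
    show "Int_stable ?C" by (auto simp: Int_stable_def)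
    fix A assume A: "A \<in> ?C"
    have [measurable]: "(\<lambda>\<omega>. measure (\<alpha> n \<omega>) A) \<in> borel_measurable M" for n
      by (rule \<alpha>_measurable[OF C_borel[OF A]])
    have "(\<lambda>\<omega>. ennreal (if \<omega> \<in> N then measure (\<alpha> 0 \<omega>) A else lim (\<lambda>n. measure (\<alpha> n \<omega>) A))) \<in> borel_measurable M"
      by measurable
    also have "?this \<longleftrightarrow> (\<lambda>\<omega>. emeasure (\<beta> \<omega>) A) \<in> borel_measurable M"
    proof (rule measurable_cong)
      fix \<omega> assume w: "\<omega> \<in> space M"
      interpret \<beta>: prob_space "\<beta> \<omega>" by (rule \<beta>_prob[OF w])
      show "ennreal (if \<omega> \<in> N then measure (\<alpha> 0 \<omega>) A else lim (\<lambda>n. measure (\<alpha> n \<omega>) A)) = emeasure (\<beta> \<omega>) A"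
        using limit_\<beta>[OF w] A unfolding \<beta>.emeasure_eq_measure
        by (cases "\<omega> \<in> N") (auto simp: \<beta>_def limit_def intro!: arg_cong[where f = ennreal] limI)
    qed
    finally show "(\<lambda>\<omega>. emeasure (\<beta> \<omega>) A) \<in> borel_measurable M" .
  qed (use \<beta>_prob in auto)
  moreover have "AE \<omega> in M. \<forall>A\<in>?C. (\<lambda>n. measure (\<alpha> n \<omega>) A) \<longlonglongrightarrow> measure (\<beta> \<omega>) A"
    using AE_not_in[OF N(1)] AE_space by eventually_elim (use limit_\<beta> in \<open>simp add: limit_def\<close>)
  ultimately show ?thesis by blast
qed

lemma AE_weakly_converges_if_setwise:
  fixes U :: "nat \<Rightarrow> 'e set"
  assumes U: "topological_basis (range U)" and \<beta>: "\<beta> \<in> M \<rightarrow>\<^sub>M prob_algebra borel"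
    and lim: "AE \<omega> in M. \<forall>A\<in>countable_algebra U. (\<lambda>n. measure (\<alpha> n \<omega>) A) \<longlonglongrightarrow> measure (\<beta> \<omega>) A"
  shows "AE \<omega> in M. weakly_converges (\<lambda>n. \<alpha> n \<omega>) (\<beta> \<omega>)"
  using lim AE_space
proof eventually_elim
  case (elim \<omega>)
  interpret C: algebra UNIV "countable_algebra U" by (rule algebra_countable_algebra)
  show ?case
  proof (rule weakly_converges_if_pi_system_converges[where P = "countable_algebra U"])
    show "prob_space (\<alpha> n \<omega>)" "sets (\<alpha> n \<omega>) = sets borel" for n
      by (rule \<alpha>_prob[OF elim(2)])+
    show "prob_space (\<beta> \<omega>)" "sets (\<beta> \<omega>) = sets borel"
      using measurable_space[OF \<beta> elim(2)] by (auto simp: space_prob_algebra)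
    show "countable_algebra U \<subseteq> sets borel"
      using sigma_sets_countable_algebra[OF U] by auto
    show "\<exists>A :: nat \<Rightarrow> 'e set. range A \<subseteq> countable_algebra U \<and> W = (\<Union>i. A i)" if "open W" for W
      by (rule open_countable_union_basis[OF U that]) (auto simp: countable_algebra_generator)
    show "A \<inter> A' \<in> countable_algebra U" if "A \<in> countable_algebra U" "A' \<in> countable_algebra U" for A A'
      using that by (rule C.Int)
    show "(\<lambda>n. measure (\<alpha> n \<omega>) A) \<longlonglongrightarrow> measure (\<beta> \<omega>) A" if "A \<in> countable_algebra U" for A
      using elim(1) that by blast
  qed
qed

text \<open>The event is described by uncountably many test functions and \<open>M\<close> need not be complete, so its
  measurability rests on the countable criterion.\<close>

lemma weak_convergence_event_measurable:
  assumes \<beta>: "\<beta> \<in> M \<rightarrow>\<^sub>M prob_algebra borel"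
  shows "{\<omega>\<in>space M. weakly_converges (\<lambda>n. \<alpha> n \<omega>) (\<beta> \<omega>)} \<in> sets M"
proof -
  obtain U :: "nat \<Rightarrow> 'e set" where U: "topological_basis (range U)"
    using ex_enumerated_basis by blast
  have \<beta>_prob: "prob_space (\<beta> \<omega>)" "sets (\<beta> \<omega>) = sets borel" if "\<omega> \<in> space M" for \<omega>
    using measurable_space[OF \<beta> that] by (auto simp: space_prob_algebra)
  have V: "(\<Union>i\<in>set s. U i) \<in> sets borel" for s
    using U by (intro borel_open open_UN) (auto simp: topological_basis_open)
  have [measurable]: "(\<lambda>\<omega>. measure (\<alpha> n \<omega>) (\<Union>i\<in>set s. U i)) \<in> borel_measurable M"
     "(\<lambda>\<omega>. measure (\<beta> \<omega>) (\<Union>i\<in>set s. U i)) \<in> borel_measurable M" for n s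
    by (rule \<alpha>_measurable[OF V], rule measurable_compose[OF measurable_prob_algebraD[OF \<beta>]
      measurable_measure_subprob_algebra[OF V]])
  define lower where "lower \<omega> \<longleftrightarrow> (\<forall>(s :: nat list) k. \<forall>\<^sub>F n in sequentially.
    measure (\<beta> \<omega>) (\<Union>i\<in>set s. U i) - inverse (real (Suc k)) < measure (\<alpha> n \<omega>) (\<Union>i\<in>set s. U i))" for \<omega>
  have "weakly_converges (\<lambda>n. \<alpha> n \<omega>) (\<beta> \<omega>) \<longleftrightarrow> lower \<omega>" if w: "\<omega> \<in> space M" for \<omega>
    unfolding lower_def
    by (rule weakly_converges_iff_countable[where \<mu> = "\<lambda>n. \<alpha> n \<omega>"])
      (rule \<alpha>_prob[OF w] \<beta>_prob[OF w] U)+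
  then have "{\<omega>\<in>space M. weakly_converges (\<lambda>n. \<alpha> n \<omega>) (\<beta> \<omega>)} = {\<omega>\<in>space M. lower \<omega>}"
    by blast
  also have "\<dots> \<in> sets M" unfolding lower_def eventually_sequentially by measurable
  finally show ?thesis .
qed

lemma measure_shifted_law_cylinder:
  fixes A :: "nat \<Rightarrow> 'e set"
  assumes A: "\<And>j. j < k \<Longrightarrow> A j \<in> sets borel"
  shows "measure (distr M borel (\<lambda>\<omega> i. X (Suc n + i) \<omega>)) {x. \<forall>j<k. x j \<in> A j} =
    (\<integral>\<omega>. (\<Prod>j<k. indicat_real (A j) (X (Suc (n + j)) \<omega>)) \<partial>M)"
proof -
  let ?S = "\<lambda>\<omega> i. X (Suc n + i) \<omega>"
  have S: "?S \<in> borel_measurable M"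
    by (rule measurable_coordinatewise_then_product) (simp add: X_measurable)
  have B: "{x. \<forall>j<k. x j \<in> A j} \<in> sets borel"
    using cylinder_borel[of "{..<k}" A] A by (simp add: Ball_def)
  define E where "E = ?S -` {x. \<forall>j<k. x j \<in> A j} \<inter> space M"
  have E [measurable]: "E \<in> sets M" unfolding E_def by (rule measurable_sets[OF S B])
  have E_iff: "\<omega> \<in> E \<longleftrightarrow> (\<forall>j<k. X (Suc (n + j)) \<omega> \<in> A j)" if "\<omega> \<in> space M" for \<omega>
    using that by (simp add: E_def)
  have "measure (distr M borel ?S) {x. \<forall>j<k. x j \<in> A j} = prob E"
    unfolding E_def by (rule measure_distr[OF S B])
  also have "\<dots> = (\<integral>\<omega>. indicator E \<omega> \<partial>M)" by simp
  also have "\<dots> = (\<integral>\<omega>. (\<Prod>j<k. indicat_real (A j) (X (Suc (n + j)) \<omega>)) \<partial>M)"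
  proof (rule Bochner_Integration.integral_cong)
    fix \<omega> assume w: "\<omega> \<in> space M"
    show "indicator E \<omega> = (\<Prod>j<k. indicat_real (A j) (X (Suc (n + j)) \<omega>))"
    proof (cases "\<omega> \<in> E")
      case True
      then have "(\<Prod>j<k. indicat_real (A j) (X (Suc (n + j)) \<omega>)) = 1"
        using E_iff[OF w] by (intro prod.neutral) auto
      then show ?thesis using True by simp
    next
      case False
      then obtain j where "j < k" "X (Suc (n + j)) \<omega> \<notin> A j" using E_iff[OF w] by blast
      then have "(\<Prod>j<k. indicat_real (A j) (X (Suc (n + j)) \<omega>)) = 0"
        by (intro prod_zero) (auto intro!: bexI[of _ j])
      then show ?thesis using False by simp
    qed
  qed simp
  finally show ?thesis .
qed

lemma shifted_laws_converge_weakly: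
  fixes U :: "nat \<Rightarrow> 'e set"
  assumes U: "topological_basis (range U)" and \<beta>: "\<beta> \<in> M \<rightarrow>\<^sub>M prob_algebra borel"
    and lim: "AE \<omega> in M. \<forall>A\<in>countable_algebra U. (\<lambda>n. measure (\<alpha> n \<omega>) A) \<longlonglongrightarrow> measure (\<beta> \<omega>) A"
  shows "weakly_converges (\<lambda>n. distr M borel (\<lambda>\<omega> i. X (n + i) \<omega>)) (iid_mixture M \<beta>)"
proof -
  let ?C = "countable_algebra U"
  interpret C: algebra UNIV ?C by (rule algebra_countable_algebra)
  have C_borel: "A \<in> sets borel" if "A \<in> ?C" for A
    using sigma_sets_countable_algebra[OF U] that by auto
  have shifted: "weakly_converges (\<lambda>n. distr M borel (\<lambda>\<omega> i. X (Suc n + i) \<omega>)) (iid_mixture M \<beta>)"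
  proof (rule weakly_converges_if_pi_system_converges[where P = "cylinders ?C"])
    show "prob_space (distr M borel (\<lambda>\<omega> i. X (Suc n + i) \<omega>))" for n
      by (intro prob_space_distr measurable_coordinatewise_then_product) (simp add: X_measurable)
    show "sets (distr M borel (\<lambda>\<omega> i. X (Suc n + i) \<omega>)) = sets borel" for n by simp
    show "prob_space (iid_mixture M \<beta>)" by (rule prob_space_iid_mixture[OF prob_space_axioms \<beta>])
    show "sets (iid_mixture M \<beta>) = sets borel" by (rule sets_iid_mixture[OF prob_space_axioms \<beta>])
    show "cylinders ?C \<subseteq> sets borel" by (rule cylinders_borel) (use C_borel in blast)
    show "B \<inter> B' \<in> cylinders ?C" if "B \<in> cylinders ?C" "B' \<in> cylinders ?C" for B B'
      by (rule cylinders_Int[OF C.top C.Int that])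
    show "(\<lambda>n. measure (distr M borel (\<lambda>\<omega> i. X (Suc n + i) \<omega>)) B) \<longlonglongrightarrow> measure (iid_mixture M \<beta>) B"
      if "B \<in> cylinders ?C" for B
    proof -
      from that obtain k D where B: "B = {x. \<forall>j<k. x j \<in> D j}" and "\<forall>j. D j \<in> ?C"
        by (rule cylindersE)
      then have D: "D j \<in> ?C" for j by blast
      note D_borel = C_borel[OF D]
      have "(\<lambda>n. \<integral>\<omega>. 1 * (\<Prod>j<k. indicat_real (D j) (X (Suc (n + j)) \<omega>)) \<partial>M)
          \<longlonglongrightarrow> (\<integral>\<omega>. 1 * (\<Prod>j<k. measure (\<beta> \<omega>) (D j)) \<partial>M)"
      proof (rule cylinder_expectation_tendsto[OF D_borel])
        show "(\<lambda>\<omega>. measure (\<beta> \<omega>) (D j)) \<in> borel_measurable M" for j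
          by (rule measurable_compose[OF measurable_prob_algebraD[OF \<beta>]
            measurable_measure_subprob_algebra[OF D_borel]])
        show "AE \<omega> in M. (\<lambda>n. measure (\<alpha> n \<omega>) (D j)) \<longlonglongrightarrow> measure (\<beta> \<omega>) (D j)" for j
          using lim by eventually_elim (use D in blast)
      qed auto
      moreover have "measure (iid_mixture M \<beta>) B = (\<integral>\<omega>. (\<Prod>j<k. measure (\<beta> \<omega>) (D j)) \<partial>M)"
        using measure_iid_mixture[OF prob_space_axioms \<beta>, of "{..<k}" D] D_borel
        by (simp add: B Ball_def)
      ultimately show ?thesis
        unfolding B using measure_shifted_law_cylinder[of k D] D_borel by simp
    qed
    show "\<exists>B :: nat \<Rightarrow> (nat \<Rightarrow> 'e) set. range B \<subseteq> cylinders ?C \<and> W = (\<Union>i. B i)" if "open W" for W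
      by (rule cylinders_exhaust_open[OF U that]) (auto simp: countable_algebra_generator)
  qed
  \<comment> \<open>The first law is skipped because it involves \<open>X 0\<close>, which need not be measurable.\<close>
  show ?thesis
    unfolding weakly_converges_def
  proof (intro allI impI)
    fix f :: "(nat \<Rightarrow> 'e) \<Rightarrow> real"
    assume f: "continuous_on UNIV f \<and> bounded (range f)"
    show "(\<lambda>n. \<integral>x. f x \<partial>distr M borel (\<lambda>\<omega> i. X (n + i) \<omega>)) \<longlonglongrightarrow> (\<integral>x. f x \<partial>iid_mixture M \<beta>)"
      by (rule LIMSEQ_imp_Suc) (rule shifted[unfolded weakly_converges_def, rule_format, OF f])
  qed
qed

end

theorem theorem1:
  fixes M :: "'a measure"
    and G :: "nat \<Rightarrow> 'a measure"
    and X :: "nat \<Rightarrow> 'a \<Rightarrow> 'e::polish_space"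
    and \<xi> :: "nat \<Rightarrow> 'a \<Rightarrow> real"
    and \<alpha>seq :: "nat \<Rightarrow> 'a \<Rightarrow> 'e measure"
  assumes "prob_space M"
    and "filtration (space M) G"
    and "\<And>n. subalgebra M (G n)"
    and "sets (G 0) = {{}, space M}"
    and "\<And>n. n \<ge> 1 \<Longrightarrow> X n \<in> borel_measurable (G n)"
    and "acid M G \<xi> X"
    and "\<And>n. regular_cond_distribution M (G n) (X (n + 1)) (\<alpha>seq n)"
    and "AE \<omega> in M. summable (\<lambda>n. \<xi> n \<omega>)"
  shows "\<exists>\<alpha>. \<alpha> \<in> M \<rightarrow>\<^sub>M prob_algebra borel \<and>
     measure M {\<omega>\<in>space M. weakly_converges (\<lambda>n. \<alpha>seq n \<omega>) (\<alpha> \<omega>)} = 1 \<and>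
     (\<exists>(N :: (nat \<Rightarrow> 'e) measure) Z.
        prob_space N \<and> exchangeable N Z \<and> directed_by N Z M \<alpha> \<and>
        weakly_converges (\<lambda>n. distr M borel (\<lambda>\<omega> i. X (n + i) \<omega>)) (distr N borel (\<lambda>\<omega> i. Z i \<omega>)))"
proof -
  interpret prob_space M by fact
  interpret acid_sequence M G \<xi> X \<alpha>seq
  proof
    show "sets (G m) \<subseteq> sets (G n)" if "m \<le> n" for m n
      by (rule filtration.sets_F_mono[OF assms(2) that])
    show "\<xi> n \<in> borel_measurable (G n)" for n using assms(6) by (simp add: acid_def)
    show "0 \<le> \<xi> n \<omega>" if "\<omega> \<in> space M" for n \<omega> using assms(6) that by (simp add: acid_def)
  qed (fact assms)+
  obtain U :: "nat \<Rightarrow> 'e set" where U: "topological_basis (range U)"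
    using ex_enumerated_basis by blast
  obtain \<alpha> where \<alpha>: "\<alpha> \<in> M \<rightarrow>\<^sub>M prob_algebra borel" and lim: "AE \<omega> in M. \<forall>A\<in>countable_algebra U.
      (\<lambda>n. measure (\<alpha>seq n \<omega>) A) \<longlonglongrightarrow> measure (\<alpha> \<omega>) A"
    using ex_setwise_limit_kernel[OF U] by blast
  have one: "measure M {\<omega>\<in>space M. weakly_converges (\<lambda>n. \<alpha>seq n \<omega>) (\<alpha> \<omega>)} = 1"
    by (rule prob_Collect_eq_1[THEN iffD2, OF weak_convergence_event_measurable[OF \<alpha>]
      AE_weakly_converges_if_setwise[OF U \<alpha> lim]])
  let ?N = "iid_mixture M \<alpha>"
  have id: "distr ?N borel (\<lambda>x i. x i) = ?N"
    by (rule distr_id2[OF sets_iid_mixture[OF assms(1) \<alpha>, symmetric]])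
  show ?thesis
  proof (intro exI conjI)
    show "\<alpha> \<in> M \<rightarrow>\<^sub>M prob_algebra borel" by (rule \<alpha>)
    show "measure M {\<omega>\<in>space M. weakly_converges (\<lambda>n. \<alpha>seq n \<omega>) (\<alpha> \<omega>)} = 1" by (rule one)
    show "prob_space ?N" by (rule prob_space_iid_mixture[OF assms(1) \<alpha>])
    show "exchangeable ?N (\<lambda>i x. x i)" by (rule exchangeable_iid_mixture[OF assms(1) \<alpha>])
    show "directed_by ?N (\<lambda>i x. x i) M \<alpha>" by (rule directed_by_iid_mixture[OF assms(1) \<alpha>])
    show "weakly_converges (\<lambda>n. distr M borel (\<lambda>\<omega> i. X (n + i) \<omega>)) (distr ?N borel (\<lambda>x i. x i))"
      unfolding id by (rule shifted_laws_converge_weakly[OF U \<alpha> lim])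
  qed
qed

end
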